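(* Let $N\ge 1$, $\ell\in\{0,1,\ldots,N\}$, and define $$\mathcal{S}_\ell(x,y)=\prod_{m=1}^N\prod_{n=1}^{N-\ell}\frac{G(x_m-y_n-\rho/2)}{G(x_m-y_n+\rho/2)},\qquad \mathcal{S}_N\equiv 1,$$ for $x\in\mathbb{C}^N$, $y\in\mathbb{C}^{N-\ell}$. Then for every $k\in\{1,\ldots,N\}$ and $\tau,\delta\in\{+,-\}$ we have, as an identity of meromorphic functions, $$A_{\tau k,\delta}(x_1,\ldots,x_N)\,\mathcal{S}_\ell(x,y)=\sum_{j=0}^{\min(k,\ell)}c^\delta_{\ell,j}\,A_{-\tau(k-j),\delta}(y_1,\ldots,y_{N-\ell})\,\mathcal{S}_\ell(x,y),$$ where $A_{\pm m,\delta}(y_1,\ldots,y_{N-\ell})\equiv 0$ for $m>N-\ell$ and $A_{0,\delta}\equiv 1$.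
   Context: Fix $a_+,a_->0$, $a=(a_++a_-)/2$, and a complex parameter $\rho$. For $\delta\in\{+,-\}$ write $-\delta$ for the opposite sign, $e_\delta(z)=\exp(\pi z/a_\delta)$ and $s_\delta(z)=\sinh(\pi z/a_\delta)$. The hyperbolic gamma function $G(z)=G(a_+,a_-;z)$ is the meromorphic function on $\mathbb{C}$ given for $|\mathrm{Im}\, z|<a$ by $G(z)=\exp\Big(i\int_0^\infty\frac{dy}{y}\Big(\frac{\sin(2yz)}{2\sinh(a_+y)\sinh(a_-y)}-\frac{z}{a_+a_-y}\Big)\Big)$ and extended meromorphically to $\mathbb{C}$; it satisfies $G(z+ia_\delta/2)/G(z-ia_\delta/2)=2\cosh(\pi z/a_{-\delta})$. For a meromorphic function $f$ and $c\in\mathbb{C}$, $\exp(\mp i c\,\partial_{x_m})$ acts by $f(x)\mapsto f(x_1,\ldots,x_m\mp ic,\ldots,x_N)$. For $n$ variables $x=(x_1,\ldots,x_n)$ and $k=1,\ldots,n$, define the analytic difference operators $$A_{\pm k,\delta}(x)=\sum_{I\subset\{1,\ldots,n\},\,|I|=k}\ \prod_{m\in I,\,n'\notin I}\frac{s_\delta(x_m-x_{n'}\mp\rho)}{s_\delta(x_m-x_{n'})}\ \prod_{m\in I}\exp(\mp i a_{-\delta}\partial_{x_m}).$$ The coefficients are $c^\delta_{0,0}=1$, $c^\delta_{\ell,j}=0$ for $j>\ell$ or $j<0$, and for $0\le j\le \ell$, $c^\delta_{\ell,j}=S_j\big(e_\delta((\ell-1)\rho),e_\delta((\ell-3)\rho),\ldots,e_\delta(-(\ell-1)\rho)\big)$,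 where $S_j$ is the $j$-th elementary symmetric function of the $\ell$ listed arguments. *)

theory Defs
  imports "HOL-Complex_Analysis.Complex_Analysis"
begin

datatype pm = Pl | Mi

fun pmneg :: "pm \<Rightarrow> pm" where "pmneg Pl = Mi" | "pmneg Mi = Pl"

fun pmsign :: "pm \<Rightarrow> complex" where "pmsign Pl = 1" | "pmsign Mi = -1"

fun adelta :: "real \<Rightarrow> real \<Rightarrow> pm \<Rightarrow> real" where
  "adelta ap am Pl = ap" | "adelta ap am Mi = am"

definition e_d :: "real \<Rightarrow> real \<Rightarrow> pm \<Rightarrow> complex \<Rightarrow> complex" where
  "e_d ap am d z = exp (of_real pi * z / of_real (adelta ap am d))"

definition s_d :: "real \<Rightarrow> real \<Rightarrow> pm \<Rightarrow> complex \<Rightarrow> complex" where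
  "s_d ap am d z = sinh (of_real pi * z / of_real (adelta ap am d))"

text \<open>Integral representation of the hyperbolic gamma function on the strip |Im z| < a.\<close>
definition hyp_gamma_integral :: "real \<Rightarrow> real \<Rightarrow> complex \<Rightarrow> complex" where
  "hyp_gamma_integral ap am z =
     exp (\<i> * (LINT y:{0<..}|lborel.
        (sin (2 * of_real y * z) / of_real (2 * sinh (ap * y) * sinh (am * y))
          - z / of_real (ap * am * y)) / of_real y))"

definition Aop :: "real \<Rightarrow> real \<Rightarrow> complex \<Rightarrow> pm \<Rightarrow> pm \<Rightarrow> nat \<Rightarrow> nat
    \<Rightarrow> ((nat \<Rightarrow> complex) \<Rightarrow> complex) \<Rightarrow> (nat \<Rightarrow> complex) \<Rightarrow> complex" where
  "Aop ap am \<rho> s d n k f x =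
     (\<Sum>I\<in>{I. I \<subseteq> {1..n} \<and> card I = k}.
        (\<Prod>m\<in>I. \<Prod>n'\<in>{1..n} - I.
            s_d ap am d (x m - x n' - pmsign s * \<rho>) / s_d ap am d (x m - x n'))
        * f (\<lambda>j. if j \<in> I then x j - pmsign s * \<i> * of_real (adelta ap am (pmneg d)) else x j))"

definition cf :: "real \<Rightarrow> real \<Rightarrow> complex \<Rightarrow> pm \<Rightarrow> nat \<Rightarrow> nat \<Rightarrow> complex" where
  "cf ap am \<rho> d l j =
     (if j \<le> l then
        (\<Sum>J\<in>{J. J \<subseteq> {0..<l} \<and> card J = j}.
           \<Prod>r\<in>J. e_d ap am d (of_int (int l - 1 - 2 * int r) * \<rho>))
      else 0)"

definition Skernel :: "(complex \<Rightarrow> complex) \<Rightarrow> complex \<Rightarrow> nat \<Rightarrow> nat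
    \<Rightarrow> (nat \<Rightarrow> complex) \<Rightarrow> (nat \<Rightarrow> complex) \<Rightarrow> complex" where
  "Skernel G \<rho> N l x y =
     (\<Prod>m\<in>{1..N}. \<Prod>n\<in>{1..N - l}. G (x m - y n - \<rho> / 2) / G (x m - y n + \<rho> / 2))"

end

theory Submission
  imports Defs "HOL-Real_Asymp.Real_Asymp"
begin

text \<open>
  On the imaginary axis the integral representation of \<open>G\<close> is real, and
  \<open>ln (G (\<i> (t + p / 2)) / G (\<i> (t - p / 2)))\<close> becomes the integral over \<open>y > 0\<close> of
  \<open>(1 / (m y) - cosh (2 t y) / sinh (m y)) / y\<close>. Expanding \<open>1 / sinh\<close> geometrically reduces it to
  Frullani integrals and the product formula for the cosine. This gives the shift equation of \<open>G\<close> on a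
  segment, hence everywhere by the identity theorem.

  The shift equation turns the claim into an identity between rational functions of
  \<open>X = exp (2 \<pi> x / a)\<close>, \<open>Y\<close> and \<open>q\<close>. To prove it, let \<open>D (X, Y)\<close> be the determinant with the Cauchy
  columns \<open>1 / (X\<^sub>i - Y\<^sub>j)\<close> and the Vandermonde columns \<open>1, X\<^sub>i, \<dots>, X\<^sub>i ^ (l - 1)\<close>, and apply \<open>1 + v T\<^sub>i\<close> to
  each row, where \<open>T\<^sub>i\<close> replaces \<open>X\<^sub>i\<close> by \<open>q X\<^sub>i\<close>. Expanding by rows gives the sum over subsets of the
  \<open>X\<^sub>i\<close>. Expanding by columns gives the sum over subsets of the \<open>Y\<^sub>j\<close>, because
  \<open>1 / (q X - Y) = q\<^sup>-\<^sup>1 / (X - q\<^sup>-\<^sup>1 Y)\<close>, times the factors \<open>1 + v q ^ p\<close> from the Vandermonde columns,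
  which generate the coefficients \<open>cf\<close>. The product formula for \<open>D\<close> identifies the summands.
\<close>

section \<open>The shift equation of the hyperbolic gamma function\<close>

text \<open>The integrand is the integral of exp (- s y) over s from c to b. Tonelli exchanges the
  two integrals, and the inner one over y > 0 becomes 1 / s.\<close>

lemma frullani_exp_nn:
  fixes b c :: real
  assumes "0 < c" "c \<le> b"
  shows "(\<integral>\<^sup>+y. ennreal (indicator {0<..} y * ((exp (- c * y) - exp (- b * y)) / y)) \<partial>lborel)
           = ennreal (ln b - ln c)"
proof -
  have "(\<integral>\<^sup>+y. ennreal (indicator {0<..} y * ((exp (- c * y) - exp (- b * y)) / y)) \<partial>lborel)
      = (\<integral>\<^sup>+y. (\<integral>\<^sup>+s. ennreal (exp (- s * y)) * indicator {c..b} s * indicator {0<..} y \<partial>lborel) \<partial>lborel)"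
  proof (rule nn_integral_cong)
    fix y :: real
    show "ennreal (indicator {0<..} y * ((exp (- c * y) - exp (- b * y)) / y))
        = (\<integral>\<^sup>+s. ennreal (exp (- s * y)) * indicator {c..b} s * indicator {0<..} y \<partial>lborel)"
    proof (cases "y > 0")
      case True
      have "(\<integral>\<^sup>+s. ennreal (exp (- s * y)) * indicator {c..b} s \<partial>lborel)
          = ennreal (- exp (- b * y) / y - (- exp (- c * y) / y))"
        using True assms
        by (intro nn_integral_FTC_Icc) (auto intro!: derivative_eq_intros)
      with True show ?thesis by (simp add: diff_divide_distrib)
    qed simp
  qed
  also have "\<dots> = (\<integral>\<^sup>+s. (\<integral>\<^sup>+y. ennreal (exp (- s * y)) * indicator {c..b} s * indicator {0<..} y \<partial>lborel) \<partial>lborel)"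
    by (rule lborel_pair.Fubini') simp
  also have "\<dots> = (\<integral>\<^sup>+s. ennreal (1 / s) * indicator {c..b} s \<partial>lborel)"
  proof (rule nn_integral_cong)
    fix s :: real
    show "(\<integral>\<^sup>+y. ennreal (exp (- s * y)) * indicator {c..b} s * indicator {0<..} y \<partial>lborel)
        = ennreal (1 / s) * indicator {c..b} s"
    proof (cases "s \<in> {c..b}")
      case True
      hence s: "s > 0" using assms by auto
      have "(\<integral>\<^sup>+y. ennreal (exp (- s * y)) * indicator {0<..} y \<partial>lborel)
          = (\<integral>\<^sup>+y. ennreal (exp (- s * y)) * indicator {0..} y \<partial>lborel)"
        by (rule nn_integral_cong_AE, rule AE_I[where N = "{0}"])
           (auto simp: indicator_def split: if_splits)
      also have "\<dots> = ennreal (0 - (- exp (- s * 0) / s))"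
      proof (rule nn_integral_FTC_atLeast)
        have "filterlim (\<lambda>y. - (s * y)) at_bot at_top"
          using s by (simp add: filterlim_uminus_at_bot filterlim_tendsto_pos_mult_at_top[OF tendsto_const] filterlim_ident)
        from filterlim_compose[OF exp_at_bot this]
        have "((\<lambda>y. exp (- s * y)) \<longlongrightarrow> 0) at_top" by simp
        from tendsto_divide[OF tendsto_minus[OF this] tendsto_const[of s]] s
        show "((\<lambda>y. - exp (- s * y) / s) \<longlongrightarrow> 0) at_top" by simp
      qed (use s in \<open>auto intro!: derivative_eq_intros\<close>)
      finally show ?thesis using True s by (simp add: mult_ac)
    qed simp
  qed
  also have "\<dots> = ennreal (ln b - ln c)"
    using assms by (intro nn_integral_FTC_Icc) (auto intro!: derivative_eq_intros simp: field_simps)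
  finally show ?thesis .
qed

lemma frullani_exp:
  fixes b c :: real
  assumes "0 < c" "c \<le> b"
  shows "has_bochner_integral lborel
           (\<lambda>y. indicator {0<..} y * ((exp (- c * y) - exp (- b * y)) / y)) (ln b - ln c)"
  using assms frullani_exp_nn[OF assms]
  by (intro has_bochner_integral_nn_integral)
     (auto simp: indicator_def intro!: AE_I2 divide_nonneg_pos)

text \<open>In the sine product at 2 x the even factors form the sine product at x and the odd ones
  the product wanted here, so the latter tends to sin (2 pi x) / (2 sin (pi x)). The bound on x
  keeps the divisors nonzero once x = 0 is set aside.\<close>

lemma cos_product_formula:
  fixes x :: real
  assumes "\<bar>x\<bar> < 1 / 2"
  shows "(\<lambda>n. \<Prod>k<n. 1 - 4 * x\<^sup>2 / (2 * real k + 1)\<^sup>2) \<longlonglongrightarrow> cos (pi * x)"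
proof (cases "x = 0")
  case False
  have split: "(\<Prod>k=1..2*n. 1 - (2*x)^2 / (real k)^2)
      = (\<Prod>k<n. 1 - 4 * x\<^sup>2 / (2 * real k + 1)\<^sup>2) * (\<Prod>k=1..n. 1 - x^2 / (real k)^2)" for n
  proof (induction n)
    case (Suc n)
    have "{1..2 * Suc n} = insert (2 * n + 2) (insert (2 * n + 1) {1..2 * n})" by auto
    moreover have "(2 * x)\<^sup>2 / (real (2 * n + 2))\<^sup>2 = x\<^sup>2 / (real (Suc n))\<^sup>2"
    proof -
      have "real (2 * n + 2) = 2 * real (Suc n)" by simp
      thus ?thesis by (simp only: power_mult_distrib) simp
    qed
    moreover have "(2 * x)\<^sup>2 / (real (2 * n + 1))\<^sup>2 = 4 * x\<^sup>2 / (2 * real n + 1)\<^sup>2"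
      by (simp add: power_mult_distrib algebra_simps)
    ultimately have "(\<Prod>k=1..2*Suc n. 1 - (2*x)^2 / (real k)^2) = (1 - x\<^sup>2 / (real (Suc n))\<^sup>2)
        * ((1 - 4 * x\<^sup>2 / (2 * real n + 1)\<^sup>2) * (\<Prod>k=1..2*n. 1 - (2*x)^2 / (real k)^2))"
      by (simp del: of_nat_add of_nat_mult of_nat_Suc)
    thus ?case by (simp only: Suc lessThan_Suc prod.insert finite_lessThan lessThan_iff prod.nat_ivl_Suc' less_irrefl) (simp add: mult_ac)
  qed simp
  have nz: "(\<Prod>k=1..n. 1 - x^2 / (real k)^2) \<noteq> 0" for n
  proof -
    have "x\<^sup>2 \<noteq> (real k)\<^sup>2" if "k \<ge> 1" for k :: nat
    proof -
      have "\<bar>x\<bar> < real k" using that assms by linarith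
      thus ?thesis by (metis abs_of_nat less_irrefl power2_eq_iff abs_minus)
    qed
    thus ?thesis by (auto simp: field_simps) (metis One_nat_def)
  qed
  have snz: "sin (pi * x) \<noteq> 0"
  proof
    assume "sin (pi * x) = 0"
    then obtain i :: int where "pi * x = of_int i * pi"
      by (auto simp: sin_zero_iff_int2)
    hence "x = of_int i" by simp
    with assms False show False by (cases "i = 0") auto
  qed
  have "(\<lambda>n. (\<Prod>k=1..2*n. 1 - (2*x)^2 / (real k)^2) / (\<Prod>k=1..n. 1 - x^2 / (real k)^2))
     \<longlonglongrightarrow> (sin (pi * (2 * x)) / (pi * (2 * x))) / (sin (pi * x) / (pi * x))"
  proof (rule tendsto_divide)
    have "(\<lambda>n. \<Prod>k=1..n. 1 - (2*x)^2 / (real k)^2) \<longlonglongrightarrow> sin (pi * (2 * x)) / (pi * (2 * x))"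
      using False by (intro sin_product_formula_real') auto
    moreover have "filterlim (\<lambda>n::nat. 2 * n) at_top sequentially"
      by (rule filterlim_subseq) (auto simp: strict_mono_def)
    ultimately show "(\<lambda>n. \<Prod>k=1..2*n. 1 - (2*x)^2 / (real k)^2) \<longlonglongrightarrow> sin (pi * (2 * x)) / (pi * (2 * x))"
      by (rule filterlim_compose)
  qed (use False snz sin_product_formula_real'[of x] in auto)
  also have "(sin (pi * (2 * x)) / (pi * (2 * x))) / (sin (pi * x) / (pi * x)) = cos (pi * x)"
    using False snz sin_double[of "pi * x"] by (simp add: field_simps)
  finally show ?thesis by (simp only: split nonzero_mult_div_cancel_right[OF nz])
qed auto

section \<open>Integrability on the positive half-line\<close>

lemma set_integrable_inverse_square:
  fixes R :: real
  assumes "R > 0"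
  shows "set_integrable lborel {R..} (\<lambda>y. 1 / y\<^sup>2)"
  unfolding set_integrable_def
proof (rule integrableI_nn_integral_finite)
  have "(\<integral>\<^sup>+y. ennreal (indicator {R..} y *\<^sub>R (1 / y\<^sup>2)) \<partial>lborel)
      = (\<integral>\<^sup>+y. ennreal (1 / y\<^sup>2) * indicator {R..} y \<partial>lborel)"
    by (rule nn_integral_cong) (auto simp: indicator_def)
  also have "\<dots> = ennreal (0 - (- 1 / R))"
  proof (rule nn_integral_FTC_atLeast)
    show "((\<lambda>y::real. - 1 / y) \<longlongrightarrow> 0) at_top" by real_asymp
  qed (use assms in \<open>auto intro!: derivative_eq_intros simp: power2_eq_square\<close>)
  finally show "(\<integral>\<^sup>+y. ennreal (indicator {R..} y *\<^sub>R (1 / y\<^sup>2)) \<partial>lborel) = ennreal (1 / R)"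
    by simp
qed auto

text \<open>The half-line is cut into three ranges: bounded near 0, continuous on a compact
  interval, dominated by 1 / y^2 further out. Integrability thus reduces to asymptotics at both
  ends, which suits integrands whose poles at 0 cancel.\<close>

lemma set_integrable_greaterThan_0_bigo:
  fixes f :: "real \<Rightarrow> real"
  assumes cont: "continuous_on {0<..} f"
    and f0: "f \<in> O[at_right 0](\<lambda>_. 1)" and finf: "f \<in> O(\<lambda>y. 1 / y\<^sup>2)"
  shows "set_integrable lborel {0<..} f"
proof -
  from f0 obtain c1 where "eventually (\<lambda>y. norm (f y) \<le> c1) (at_right 0)"
    by (auto elim!: landau_o.bigE)
  then obtain e where e: "e > 0" "\<And>y. 0 < y \<Longrightarrow> y < e \<Longrightarrow> norm (f y) \<le> c1"
    by (auto simp: eventually_at_right_field)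
  from finf obtain c2 where c2: "c2 > 0" "eventually (\<lambda>y. norm (f y) \<le> c2 * norm (1 / y\<^sup>2)) at_top"
    by (rule landau_o.bigE)
  then obtain R0 where R0: "\<And>y. y \<ge> R0 \<Longrightarrow> norm (f y) \<le> c2 * norm (1 / y\<^sup>2)"
    by (auto simp: eventually_at_top_linorder)
  define R where "R = max R0 e"
  have R: "R > 0" "R \<ge> R0" "R \<ge> e" using e by (auto simp: R_def)
  have meas: "set_borel_measurable lborel S f" if "S \<subseteq> {0<..}" "S \<in> sets borel" for S
  proof -
    have "set_borel_measurable borel S f"
      using continuous_on_subset[OF cont that(1)] that(2)
      by (intro borel_measurable_continuous_on_indicator[folded set_borel_measurable_def])
    thus ?thesis by (simp add: set_borel_measurable_def)
  qed
  have "set_integrable lborel {0<..<e} f"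
  proof (rule set_integrable_bound)
    show "set_integrable lborel {0<..<e} (\<lambda>_. c1)"
      unfolding set_integrable_def using e
      by (intro integrable_scaleR_left integrable_real_indicator) auto
  qed (use e in \<open>auto intro!: meas AE_I2, force\<close>)
  moreover have "set_integrable lborel {e..R} f"
  proof -
    have "{e..R} \<subseteq> {0<..}" using e(1) by auto
    from borel_integrable_compact[OF _ continuous_on_subset[OF cont this]]
    show ?thesis by (simp add: set_integrable_def)
  qed
  moreover have "set_integrable lborel {R..} f"
  proof (rule set_integrable_bound)
    show "set_integrable lborel {R..} (\<lambda>y. c2 * (1 / y\<^sup>2))"
      by (intro set_integrable_mult_right set_integrable_inverse_square R)
    show "AE y in lborel. y \<in> {R..} \<longrightarrow> norm (f y) \<le> norm (c2 * (1 / y\<^sup>2))"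
      using R0 R c2(1) by (intro AE_I2) (auto simp: abs_mult intro: order_trans)
    show "set_borel_measurable lborel {R..} f"
      using R by (intro meas) auto
  qed
  ultimately have "set_integrable lborel ({0<..<e} \<union> {e..R} \<union> {R..}) f"
    by (intro set_integrable_Un) auto
  also have "{0<..<e} \<union> {e..R} \<union> {R..} = {0<..}" using e R by auto
  finally show ?thesis .
qed

section \<open>The integral behind the shift equation\<close>

lemma cos_pi_mult_div_pos:
  fixes m t :: real
  assumes "m > 0" "0 \<le> t" "t < m / 2"
  shows "cos (pi * t / m) > 0"
proof (rule cos_gt_zero_pi)
  have "0 \<le> pi * t / m" using assms by simp
  thus "- (pi / 2) < pi * t / m" using pi_gt_zero by linarith
qed (use assms in \<open>simp add: field_simps\<close>)

text \<open>Geometric series for 1 / sinh (m y) = 2 exp (- m y) / (1 - exp (- 2 m y)).\<close>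

lemma csch_sums:
  fixes m y :: real
  assumes "m > 0" "y > 0"
  shows "(\<lambda>n. 2 * exp (- (2 * real n + 1) * m * y)) sums (1 / sinh (m * y))"
proof -
  have "(\<lambda>n. 2 * exp (- m * y) * exp (- 2 * m * y) ^ n) sums (2 * exp (- m * y) * (1 / (1 - exp (- 2 * m * y))))"
    using assms by (intro sums_mult geometric_sums) auto
  moreover have "2 * exp (- m * y) * exp (- 2 * m * y) ^ n = 2 * exp (- (2 * real n + 1) * m * y)" for n
    by (simp add: exp_of_nat_mult [symmetric] exp_add [symmetric] algebra_simps)
  moreover have "2 * exp (- m * y) * (1 / (1 - exp (- 2 * m * y))) = 1 / sinh (m * y)"
  proof -
    have "exp (m * y) > 1" using assms by simp
    moreover have "exp (- 2 * m * y) = inverse (exp (m * y)) ^ 2"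
      by (simp add: exp_minus[symmetric] exp_of_nat_mult [symmetric])
    moreover have "exp (m * y) * exp (m * y) \<noteq> 1"
      using \<open>exp (m * y) > 1\<close> by (metis less_1_mult less_irrefl)
    ultimately show ?thesis
      by (simp add: sinh_def exp_minus field_simps power2_eq_square)
  qed
  ultimately show ?thesis by (simp only:)
qed

text \<open>Expanding 1 / sinh by \<open>csch_sums\<close>, each term is a difference of two
  Frullani integrands with exponents b - 2 t, b and b + 2 t for b = (2 n + 1) m, and its integral is
  - ln (1 - 4 t^2 / b^2). The cosine product sums these values. All terms are nonnegative, which
  justifies integrating term by term; subtracting 1 from cosh removes the singularity at 0.\<close>

lemma has_integral_cosh_minus_1_div_sinh:
  fixes m t :: real
  assumes m: "m > 0" and t: "0 \<le> t" "t < m / 2"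
  shows "has_bochner_integral lborel
     (\<lambda>y. indicator {0<..} y * ((cosh (2 * t * y) - 1) / (y * sinh (m * y)))) (- ln (cos (pi * t / m)))"
proof -
  define b where "b = (\<lambda>n::nat. (2 * real n + 1) * m)"
  define f where "f = (\<lambda>n y. indicator {0<..} y * (2 * (cosh (2 * t * y) - 1) * exp (- b n * y) / y) :: real)"
  define v where "v = (\<lambda>n. - ln (1 - 4 * (t / m)\<^sup>2 / (2 * real n + 1)\<^sup>2))"
  have b: "b n \<ge> m" for n using m by (simp add: b_def algebra_simps)
  have f_int: "has_bochner_integral lborel (f n) (v n)" for n
  proof -
    have pos: "0 < b n - 2 * t" "b n > 0" using b[of n] t m by linarith+
    have "has_bochner_integral lborel
        (\<lambda>y. indicator {0<..} y * ((exp (- (b n - 2 * t) * y) - exp (- b n * y)) / y)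
           - indicator {0<..} y * ((exp (- b n * y) - exp (- (b n + 2 * t) * y)) / y))
        ((ln (b n) - ln (b n - 2 * t)) - (ln (b n + 2 * t) - ln (b n)))"
      using pos t by (intro has_bochner_integral_diff frullani_exp) auto
    also have "(\<lambda>y. indicator {0<..} y * ((exp (- (b n - 2 * t) * y) - exp (- b n * y)) / y)
           - indicator {0<..} y * ((exp (- b n * y) - exp (- (b n + 2 * t) * y)) / y)) = f n"
      by (auto simp: fun_eq_iff f_def indicator_def cosh_def field_simps simp flip: exp_add)
    also have "(ln (b n) - ln (b n - 2 * t)) - (ln (b n + 2 * t) - ln (b n)) = v n"
    proof -
      have "1 - 4 * (t / m)\<^sup>2 / (2 * real n + 1)\<^sup>2 = ((b n - 2 * t) * (b n + 2 * t)) / (b n * b n)"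
      proof -
        have "4 * (t / m)\<^sup>2 / (2 * real n + 1)\<^sup>2 = 4 * t\<^sup>2 / (b n)\<^sup>2"
          using m by (simp add: b_def power_mult_distrib power_divide)
        moreover have "1 - 4 * t\<^sup>2 / (b n)\<^sup>2 = ((b n - 2 * t) * (b n + 2 * t)) / (b n * b n)"
          using pos by (simp add: field_simps power2_eq_square)
        ultimately show ?thesis by simp
      qed
      thus ?thesis using pos t by (simp add: v_def ln_mult ln_div)
    qed
    finally show ?thesis .
  qed
  have f_nonneg: "f n y \<ge> 0" for n y
    by (auto simp: f_def indicator_def intro!: divide_nonneg_pos mult_nonneg_nonneg cosh_real_ge_1)
  have f_sums: "(\<lambda>n. f n y) sums (indicator {0<..} y * ((cosh (2 * t * y) - 1) / (y * sinh (m * y))))" for y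
  proof (cases "y > 0")
    case True
    from sums_mult[OF csch_sums[OF m True], of "(cosh (2 * t * y) - 1) / y"] True
    show ?thesis by (simp add: f_def b_def algebra_simps diff_divide_distrib)
  qed (simp add: f_def)
  have x: "\<bar>t / m\<bar> < 1 / 2" using t m by (simp add: field_simps)
  have cos_pos: "cos (pi * (t / m)) > 0"
    using cos_pi_mult_div_pos[OF assms] by simp
  have fac_pos: "1 - 4 * (t / m)\<^sup>2 / (2 * real n + 1)\<^sup>2 > 0" for n
  proof -
    have "(t / m)\<^sup>2 < (1 / 2)\<^sup>2" using x by (metis abs_le_square_iff not_le abs_of_pos half_gt_zero_iff zero_less_one)
    hence "4 * (t / m)\<^sup>2 < 1" by (simp add: power2_eq_square mult_ac)
    also have "1 \<le> (2 * real n + 1)\<^sup>2" by (rule one_le_power) simp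
    finally show ?thesis by (subst diff_gt_0_iff_gt, subst divide_less_eq_1_pos) auto
  qed
  have v_sums: "v sums (- ln (cos (pi * (t / m))))"
  proof -
    have "(\<lambda>n. ln (\<Prod>k<n. 1 - 4 * (t / m)\<^sup>2 / (2 * real k + 1)\<^sup>2)) \<longlonglongrightarrow> ln (cos (pi * (t / m)))"
      using cos_product_formula[OF x] cos_pos by (intro tendsto_ln) auto
    moreover have "ln (\<Prod>k<n. 1 - 4 * (t / m)\<^sup>2 / (2 * real k + 1)\<^sup>2) = - (\<Sum>k<n. v k)" for n
      using fac_pos by (subst ln_prod) (auto simp: v_def sum_negf less_imp_neq[symmetric])
    ultimately show ?thesis by (simp add: sums_def tendsto_minus_cancel_left)
  qed
  have "integrable lborel (\<lambda>y. \<Sum>n. f n y)" "(\<integral>y. (\<Sum>n. f n y) \<partial>lborel) = (\<Sum>n. integral\<^sup>L lborel (f n))"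
  proof -
    have *: "integrable lborel (f n)" for n using f_int by (auto simp: has_bochner_integral_iff)
    have **: "AE y in lborel. summable (\<lambda>n. norm (f n y))"
      using f_sums f_nonneg by (auto simp: sums_iff)
    have ***: "summable (\<lambda>n. \<integral>y. norm (f n y) \<partial>lborel)"
      using f_int v_sums f_nonneg by (simp add: has_bochner_integral_iff sums_iff)
    show "integrable lborel (\<lambda>y. \<Sum>n. f n y)" "(\<integral>y. (\<Sum>n. f n y) \<partial>lborel) = (\<Sum>n. integral\<^sup>L lborel (f n))"
      by (rule integrable_suminf[OF * ** ***] integral_suminf[OF * ** ***])+
  qed
  moreover have "(\<Sum>n. integral\<^sup>L lborel (f n)) = - ln (cos (pi * (t / m)))"
    using f_int v_sums by (simp add: has_bochner_integral_iff sums_iff)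
  ultimately show ?thesis
    using f_sums by (simp add: has_bochner_integral_iff sums_iff)
qed

text \<open>This is what remains of the difference of the logarithmic integrands of G at \<i> (t - p
  / 2) and \<i> (t + p / 2): the factor sinh (p y) has cancelled, so p no longer occurs.\<close>

definition cosh_csch_integrand :: "real \<Rightarrow> real \<Rightarrow> real \<Rightarrow> real" where
  "cosh_csch_integrand m t y = (1 / (m * y) - cosh (2 * t * y) / sinh (m * y)) / y"

lemma set_integrable_cosh_csch_0:
  assumes "m > 0"
  shows "set_integrable lborel {0<..} (cosh_csch_integrand m 0)"
proof (rule set_integrable_greaterThan_0_bigo)
  show "continuous_on {0<..} (cosh_csch_integrand m 0)"
    unfolding cosh_csch_integrand_def using assms by (intro continuous_intros) auto
  show "cosh_csch_integrand m 0 \<in> O[at_right 0](\<lambda>_. 1)"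
    unfolding cosh_csch_integrand_def using assms by simp real_asymp
  show "cosh_csch_integrand m 0 \<in> O(\<lambda>y. 1 / y\<^sup>2)"
    unfolding cosh_csch_integrand_def using assms by simp real_asymp
qed

text \<open>The integrand at t is the one at 0 minus that of
  \<open>has_integral_cosh_minus_1_div_sinh\<close>. Hence the integral is J + ln (cos (pi t / m))
  with J independent of t, and only J = ln 2 remains to be found.\<close>

lemma cosh_csch_integral:
  assumes m: "m > 0" and t: "0 \<le> t" "t < m / 2"
  shows "(LINT y:{0<..}|lborel. cosh_csch_integrand m t y) = ln (2 * cos (pi * t / m))"
proof -
  define J where "J = (LINT y:{0<..}|lborel. cosh_csch_integrand m 0 y)"
  have J: "has_bochner_integral lborel (\<lambda>y. indicator {0<..} y * cosh_csch_integrand m t y)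
     (J + ln (cos (pi * t / m)))" if t: "0 \<le> t" "t < m / 2" for t
  proof -
    have "has_bochner_integral lborel (\<lambda>y. indicator {0<..} y * cosh_csch_integrand m 0 y) J"
      using set_integrable_cosh_csch_0[OF m]
      by (simp add: has_bochner_integral_iff set_integrable_def J_def set_lebesgue_integral_def)
    from has_bochner_integral_diff[OF this has_integral_cosh_minus_1_div_sinh[OF m t]]
    show ?thesis
      by (rule has_bochner_integral_cong[THEN iffD1, rotated -1])
         (use m in \<open>auto simp: cosh_csch_integrand_def indicator_def field_simps\<close>)
  qed
  \<comment> \<open>Scaling \<open>y\<close> by \<open>2\<close> turns \<open>cosh (m y / 2) / sinh (m y) = 1 / (2 sinh (m y / 2))\<close> into a second
      relation between the integrals at \<open>t = 0\<close> and \<open>t = m / 4\<close>, which fixes \<open>J\<close>.\<close>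
  have "J = ln 2"
  proof -
    have "has_bochner_integral lborel (\<lambda>y. indicator {0<..} y * cosh_csch_integrand m 0 y) J"
      using J[of 0] m by simp
    hence "has_bochner_integral lborel
        (\<lambda>y. indicator {0<..} (0 + (1 / 2) * y) * cosh_csch_integrand m 0 (0 + (1 / 2) * y)) (J /\<^sub>R \<bar>1 / 2\<bar>)"
      by (subst (asm) lborel_has_bochner_integral_real_affine_iff[where c = "1 / 2" and t = 0]) auto
    moreover have "indicator {0<..} (0 + (1 / 2) * y) * cosh_csch_integrand m 0 (0 + (1 / 2) * y)
        = 4 * (indicator {0<..} y * cosh_csch_integrand m (m / 4) y)" for y :: real
    proof (cases "y > 0")
      case True
      have "sinh (m * y) = 2 * sinh (m * y / 2) * cosh (m * y / 2)"
        using sinh_double[of "m * y / 2"] by simp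
      moreover have "sinh (m * y / 2) \<noteq> 0" "cosh (m * y / 2) \<noteq> 0" using True m by auto
      ultimately show ?thesis using True m
        by (simp add: cosh_csch_integrand_def field_simps)
    qed simp
    ultimately have "has_bochner_integral lborel
        (\<lambda>y. 4 * (indicator {0<..} y * cosh_csch_integrand m (m / 4) y)) (2 * J)" by simp
    moreover have "has_bochner_integral lborel
        (\<lambda>y. 4 * (indicator {0<..} y * cosh_csch_integrand m (m / 4) y)) (4 * (J + ln (cos (pi * (m / 4) / m))))"
      using m by (intro has_bochner_integral_mult_right J) auto
    ultimately have "2 * J = 4 * (J + ln (cos (pi * (m / 4) / m)))"
      by (rule has_bochner_integral_eq)
    moreover have "ln (cos (pi * (m / 4) / m)) = - ln 2 / 2"
      using m by (simp add: cos_45 ln_div ln_sqrt)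
    ultimately show ?thesis by simp
  qed
  thus "(LINT y:{0<..}|lborel. cosh_csch_integrand m t y) = ln (2 * cos (pi * t / m))"
    using J[OF t] cos_pi_mult_div_pos[OF assms] by (simp add: ln_mult has_bochner_integral_iff set_lebesgue_integral_def)
qed

section \<open>The integral representation on the imaginary axis and the shift equation\<close>

text \<open>The defining integrand of G at z = \<i> s, divided by \<i>. It is real because sin (2
  \<i> s y) = \<i> sinh (2 s y).\<close>

definition log_hyp_gamma_integrand :: "real \<Rightarrow> real \<Rightarrow> real \<Rightarrow> real \<Rightarrow> real" where
  "log_hyp_gamma_integrand p m s y =
     (sinh (2 * y * s) / (2 * sinh (p * y) * sinh (m * y)) - s / (p * m * y)) / y"

lemma hyp_gamma_integral_imaginary:
  "hyp_gamma_integral p m (\<i> * of_real s)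
     = of_real (exp (- (LINT y:{0<..}|lborel. log_hyp_gamma_integrand p m s y)))"
proof -
  have "(sin (2 * of_real y * (\<i> * of_real s)) / of_real (2 * sinh (p * y) * sinh (m * y))
          - \<i> * of_real s / of_real (p * m * y)) / of_real y
        = \<i> * complex_of_real (log_hyp_gamma_integrand p m s y)" for y
  proof -
    have "\<i> * (2 * of_real y * (\<i> * of_real s)) = (of_real (- (2 * y * s)) :: complex)" by simp
    moreover have "sinh (complex_of_real x) = of_real (sinh x)" for x
      by (simp add: sinh_def scaleR_conv_of_real flip: exp_of_real)
    ultimately have "sin (2 * of_real y * (\<i> * of_real s)) = \<i> * complex_of_real (sinh (2 * y * s))"
      by (simp only: sin_conv_sinh sinh_minus) simp
    thus ?thesis by (simp add: log_hyp_gamma_integrand_def algebra_simps diff_divide_distrib)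
  qed
  thus ?thesis
    by (simp add: hyp_gamma_integral_def set_integral_complex_of_real exp_of_real [symmetric])
qed

lemma log_hyp_gamma_integrand_minus:
  "log_hyp_gamma_integrand p m (- s) y = - log_hyp_gamma_integrand p m s y"
  by (simp add: log_hyp_gamma_integrand_def diff_divide_distrib)

text \<open>Near 0 both summands in the bracket behave like s / (p m y) and their poles cancel. At
  infinity the first decays like exp (- (p + m - 2 s) y) for s > 0, which is where the width of the
  strip enters, and the second leaves a multiple of 1 / y^2.\<close>

lemma set_integrable_log_hyp_gamma_integrand:
  fixes p m s :: real
  assumes "p > 0" "m > 0" "\<bar>s\<bar> < (p + m) / 2"
  shows "set_integrable lborel {0<..} (log_hyp_gamma_integrand p m s)"
proof -
  \<comment> \<open>The growth of sinh (2 y s) depends on the sign of s, so positive s comes first;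
    the integrand is odd in s, which settles negative s.\<close>
  have pos: "set_integrable lborel {0<..} (log_hyp_gamma_integrand p m s)"
    if s: "s > 0" "s < (p + m) / 2" for s
  proof (rule set_integrable_greaterThan_0_bigo)
    show "continuous_on {0<..} (log_hyp_gamma_integrand p m s)"
      unfolding log_hyp_gamma_integrand_def using assms by (intro continuous_intros) auto
    show "log_hyp_gamma_integrand p m s \<in> O[at_right 0](\<lambda>_. 1)"
      unfolding log_hyp_gamma_integrand_def using assms s by real_asymp
    have "(\<lambda>y. sinh (2 * y * s) * (1 / sinh (p * y)) * (1 / sinh (m * y)))
        \<in> O(\<lambda>y. exp (2 * y * s) * exp (- p * y) * exp (- m * y))"
      using assms s by (intro landau_o.big.mult) real_asymp+
    also have "(\<lambda>y. exp (2 * y * s) * exp (- p * y) * exp (- m * y)) = (\<lambda>y. exp (- (p + m - 2 * s) * y))"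
      by (simp add: fun_eq_iff algebra_simps flip: exp_add)
    also have "(\<lambda>y. exp (- e * y)) \<in> O(\<lambda>y::real. 1 / y)" if "e > 0" for e
      using that by real_asymp
    from this[of "p + m - 2 * s"] have "(\<lambda>y. exp (- (p + m - 2 * s) * y)) \<in> O(\<lambda>y::real. 1 / y)"
      using s by simp
    finally have "(\<lambda>y. 1 / 2 * (sinh (2 * y * s) * (1 / sinh (p * y)) * (1 / sinh (m * y))) - s / (p * m * y)) 
        \<in> O(\<lambda>y. 1 / y)"
      using assms s by (intro sum_in_bigo landau_o.big.cmult_in_iff[THEN iffD2]) (auto, real_asymp)
    from landau_o.big.mult[OF this landau_o.big_refl[of "\<lambda>y. 1 / y"]]
    show "log_hyp_gamma_integrand p m s \<in> O(\<lambda>y. 1 / y\<^sup>2)"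
      unfolding log_hyp_gamma_integrand_def by (simp add: power2_eq_square mult.assoc)
  qed
  consider "s > 0" | "s < 0" | "s = 0" by linarith
  thus ?thesis
  proof cases
    case 2
    with pos[of "- s"] assms show ?thesis
      by (simp add: log_hyp_gamma_integrand_minus[abs_def] set_integrable_def)
  qed (use pos[of s] assms in \<open>auto simp: log_hyp_gamma_integrand_def set_integrable_def\<close>)
qed

text \<open>By the addition theorem the numerators at t + p / 2 and t - p / 2 differ by 2 cosh (2 t
  y) sinh (p y), so the difference of the integrands is minus \<open>cosh_csch_integrand\<close>.
  The range of t keeps both points inside the strip of convergence.\<close>

lemma hyp_gamma_integral_shift_imaginary:
  assumes p: "p > 0" and m: "m > 0" and t: "0 \<le> t" "t < m / 2"
  shows "hyp_gamma_integral p m (\<i> * of_real (t + p / 2))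
    = of_real (2 * cos (pi * t / m)) * hyp_gamma_integral p m (\<i> * of_real (t - p / 2))"
proof -
  let ?L = "\<lambda>s. LINT y:{0<..}|lborel. log_hyp_gamma_integrand p m s y"
  have "?L (t + p / 2) - ?L (t - p / 2)
      = (LINT y:{0<..}|lborel. log_hyp_gamma_integrand p m (t + p / 2) y
            - log_hyp_gamma_integrand p m (t - p / 2) y)"
    using p m t by (subst set_integral_diff) (auto intro!: set_integrable_log_hyp_gamma_integrand simp: abs_if)
  also have "\<dots> = (LINT y:{0<..}|lborel. - cosh_csch_integrand m t y)"
  proof (intro set_lebesgue_integral_cong allI impI)
    fix y :: real assume "y \<in> {0<..}"
    hence y: "y > 0" by simp
    have "sinh (2 * y * (t + p / 2)) - sinh (2 * y * (t - p / 2)) = 2 * cosh (2 * t * y) * sinh (p * y)"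
      using sinh_add[of "2 * t * y" "p * y"] sinh_diff[of "2 * t * y" "p * y"] by (simp add: algebra_simps)
    moreover have "sinh (p * y) \<noteq> 0" "sinh (m * y) \<noteq> 0" using y p m by auto
    ultimately have "sinh (2 * y * (t + p / 2)) / (2 * sinh (p * y) * sinh (m * y))
        - sinh (2 * y * (t - p / 2)) / (2 * sinh (p * y) * sinh (m * y)) = cosh (2 * t * y) / sinh (m * y)"
      by (simp flip: diff_divide_distrib)
    moreover have "(t + p / 2) / (p * m * y) - (t - p / 2) / (p * m * y) = 1 / (m * y)"
      using y p m by (simp add: field_simps)
    moreover have "(A - c) / y - (B - d) / y = - ((e - f) / y)"
      if "A - B = f" "c - d = e" for A B c d e f
      unfolding that [symmetric] by (simp add: diff_divide_distrib)
    ultimately show "log_hyp_gamma_integrand p m (t + p / 2) y - log_hyp_gamma_integrand p m (t - p / 2) y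
        = - cosh_csch_integrand m t y"
      unfolding log_hyp_gamma_integrand_def cosh_csch_integrand_def
      by blast
  qed simp
  also have "\<dots> = - ln (2 * cos (pi * t / m))"
    using cosh_csch_integral[OF m t] by (simp add: set_lebesgue_integral_def)
  finally have "- ?L (t + p / 2) = ln (2 * cos (pi * t / m)) + - ?L (t - p / 2)" by simp
  hence "exp (- ?L (t + p / 2)) = 2 * cos (pi * t / m) * exp (- ?L (t - p / 2))"
    using cos_pi_mult_div_pos[OF m t] by (simp only: exp_add) simp
  thus ?thesis
    by (simp only: hyp_gamma_integral_imaginary of_real_mult [symmetric])
qed

lemma hyp_gamma_integral_commute: "hyp_gamma_integral p m z = hyp_gamma_integral m p z"
  by (simp add: hyp_gamma_integral_def mult_ac)

text \<open>The difference \<open>h\<close> of the two sides is meromorphic and vanishes on a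
  segment of the imaginary axis, hence off a discrete set. A meromorphic function may take arbitrary
  values at isolated points, so analyticity at the two arguments is what carries the equation to z
  itself.\<close>

lemma hyp_gamma_shift:
  assumes p: "p > 0" and m: "m > 0" and G: "G meromorphic_on UNIV"
    and strip: "\<And>z. \<bar>Im z\<bar> < (p + m) / 2 \<Longrightarrow> G z = hyp_gamma_integral p m z"
    and an: "G analytic_on {z + \<i> * of_real p / 2}" "G analytic_on {z - \<i> * of_real p / 2}"
  shows "G (z + \<i> * of_real p / 2) = 2 * cosh (of_real pi * z / of_real m) * G (z - \<i> * of_real p / 2)"
proof -
  define h where "h = (\<lambda>z. G (z + \<i> * of_real p / 2)
      - 2 * cosh (of_real pi * z / of_real m) * G (z - \<i> * of_real p / 2))"
  have h0: "h (\<i> * of_real t) = 0" if t: "0 \<le> t" "t < m / 2" for t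
  proof -
    have "G (\<i> * of_real t + \<i> * of_real p / 2) = hyp_gamma_integral p m (\<i> * of_real (t + p / 2))"
      using t p by (subst strip) (auto simp: algebra_simps)
    moreover have "G (\<i> * of_real t - \<i> * of_real p / 2) = hyp_gamma_integral p m (\<i> * of_real (t - p / 2))"
      using t p m by (subst strip) (auto simp: algebra_simps abs_if)
    moreover have "cosh (of_real pi * (\<i> * of_real t) / of_real m) = complex_of_real (cos (pi * t / m))"
    proof -
      have "\<i> * (of_real pi * (\<i> * of_real t) / of_real m) = complex_of_real (- (pi * t / m))"
        by (simp add: mult.left_commute[of \<i> "of_real pi"])
      thus ?thesis by (simp only: cosh_conv_cos cos_of_real cos_minus)
    qed
    ultimately show ?thesis
      using hyp_gamma_integral_shift_imaginary[OF p m t] by (simp add: h_def)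
  qed
  have mero: "h meromorphic_on UNIV"
    unfolding h_def using m
    by (intro meromorphic_intros meromorphic_on_compose[OF G] analytic_intros) (auto intro!: analytic_intros analytic_on_imp_meromorphic_on)
  \<comment> \<open>The point \<i> m / 4 is interior to the segment of zeros; letting t decrease to
    m / 4 makes it an accumulation point of zeros.\<close>
  have freq: "frequently (\<lambda>z. h z = 0) (at (\<i> * of_real (m / 4)))"
    unfolding frequently_def
  proof
    assume "eventually (\<lambda>z. \<not> h z = 0) (at (\<i> * of_real (m / 4)))"
    moreover have "filterlim (\<lambda>t. \<i> * complex_of_real t) (at (\<i> * of_real (m / 4))) (at_right (m / 4))"
    proof (rule filterlim_atI)
      show "eventually (\<lambda>t. \<i> * complex_of_real t \<noteq> \<i> * of_real (m / 4)) (at_right (m / 4))"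
        by (rule eventually_mono[OF eventually_at_right_less[of "m / 4"]]) (simp del: of_real_divide)
    qed (auto intro!: tendsto_eq_intros)
    ultimately have "eventually (\<lambda>t. h (\<i> * complex_of_real t) \<noteq> 0) (at_right (m / 4))"
      by (auto simp: filterlim_iff)
    moreover have "eventually (\<lambda>t. t \<in> {m / 4<..<m / 2}) (at_right (m / 4))"
      using m by (intro eventually_at_right_real) auto
    ultimately have "eventually (\<lambda>_. False) (at_right (m / 4))"
      by eventually_elim (use h0 m in auto)
    thus False by simp
  qed
  have "\<not> eventually (\<lambda>z. h z \<noteq> 0) (cosparse UNIV)"
    using freq by (auto simp: eventually_cosparse_open_eq frequently_def)
  hence "eventually (\<lambda>z. h z = 0) (cosparse UNIV)"
    using meromorphic_imp_constant_or_avoid[OF mero, of 0] by auto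
  hence ev: "eventually (\<lambda>w. h w = 0) (at z)"
    by (auto simp: eventually_cosparse_open_eq)
  have "isCont h z"
  proof -
    have "h analytic_on {z}"
      unfolding h_def using an m
      by (intro analytic_intros analytic_on_compose_gen[OF _ an(1), unfolded o_def]
            analytic_on_compose_gen[OF _ an(2), unfolded o_def]) (auto intro!: analytic_intros)
    thus ?thesis by (rule analytic_at_imp_isCont)
  qed
  hence "(h \<longlongrightarrow> h z) (at z)" by (simp add: isCont_def)
  moreover have "(h \<longlongrightarrow> 0) (at z)" using ev by (rule tendsto_eventually)
  ultimately have "h z = 0" by (rule tendsto_unique[rotated]) simp
  thus ?thesis by (simp add: h_def)
qed

section \<open>Cauchy--Vandermonde determinants\<close>

text \<open>The difference of the two sides has degree below \<open>card A\<close> and vanishes at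
  the \<open>card A\<close> distinct points \<open>x i\<close>.\<close>

lemma lagrange_interpolation_poly:
  fixes p :: "'a :: field poly" and x :: "'i \<Rightarrow> 'a"
  assumes A: "finite A" and inj: "inj_on x A" and deg: "degree p < card A"
  shows "p = (\<Sum>i\<in>A. smult (poly p (x i) / (\<Prod>j\<in>A - {i}. x i - x j)) (\<Prod>j\<in>A - {i}. [:- x j, 1:]))"
    (is "p = ?r")
proof -
  have degprod: "degree (\<Prod>j\<in>A - {i}. [:- x j, 1:]) = card A - 1" if "i \<in> A" for i
    using A that by (subst degree_prod_eq_sum_degree) (auto simp: card_Diff_singleton)
  have "degree ?r \<le> card A - 1"
    by (intro degree_sum_le A order.trans[OF degree_smult_le]) (simp add: degprod)
  hence dr: "degree (p - ?r) < card A"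
    using deg by (intro le_less_trans[OF degree_diff_le_max]) auto
  have root: "poly (p - ?r) (x k) = 0" if k: "k \<in> A" for k
  proof -
    have nz: "(\<Prod>j\<in>A - {k}. x k - x j) \<noteq> 0"
      using inj k A by (auto simp: inj_on_def)
    have "poly ?r (x k) = (\<Sum>i\<in>A. poly p (x i) / (\<Prod>j\<in>A - {i}. x i - x j) * (\<Prod>j\<in>A - {i}. x k - x j))"
      by (simp add: poly_sum poly_prod)
    also have "\<dots> = (\<Sum>i\<in>A. if i = k then poly p (x k) else 0)"
    proof (rule sum.cong[OF refl])
      fix i assume i: "i \<in> A"
      show "poly p (x i) / (\<Prod>j\<in>A - {i}. x i - x j) * (\<Prod>j\<in>A - {i}. x k - x j)
          = (if i = k then poly p (x k) else 0)"
      proof (cases "i = k")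
        case False
        hence "(\<Prod>j\<in>A - {i}. x k - x j) = 0" using A k by (intro prod_zero) auto
        thus ?thesis using False by simp
      qed (use nz in auto)
    qed
    also have "\<dots> = poly p (x k)" using A k by simp
    finally show ?thesis by simp
  qed
  have "p - ?r = 0"
  proof (rule ccontr)
    assume nz: "p - ?r \<noteq> 0"
    have "card (x ` A) \<le> card {z. poly (p - ?r) z = 0}"
      using root by (intro card_mono poly_roots_finite[OF nz]) auto
    also have "\<dots> \<le> degree (p - ?r)"
      by (rule card_poly_roots_bound[OF nz])
    finally show False using dr by (simp add: card_image[OF inj])
  qed
  thus ?thesis by simp
qed

text \<open>Evaluating the interpolation formula at z and dividing by the product of all z - x i
  gives the partial fraction expansion; the sign comes from writing x i - z instead of z - x
  i.\<close>

lemma partial_fraction_sum: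
  fixes p :: "'a :: field poly" and x :: "'i \<Rightarrow> 'a"
  assumes A: "finite A" and inj: "inj_on x A" and deg: "degree p < card A"
    and z: "\<And>i. i \<in> A \<Longrightarrow> x i \<noteq> z"
  shows "(\<Sum>i\<in>A. poly p (x i) / ((x i - z) * (\<Prod>j\<in>A - {i}. x i - x j))) = - poly p z / (\<Prod>i\<in>A. z - x i)"
proof -
  have nz: "(\<Prod>i\<in>A. z - x i) \<noteq> 0" using A z by auto
  have "poly p z = poly (\<Sum>i\<in>A. smult (poly p (x i) / (\<Prod>j\<in>A - {i}. x i - x j)) (\<Prod>j\<in>A - {i}. [:- x j, 1:])) z"
    by (subst lagrange_interpolation_poly[OF A inj deg]) (rule refl)
  also have "\<dots> = (\<Sum>i\<in>A. poly p (x i) / (\<Prod>j\<in>A - {i}. x i - x j) * (\<Prod>j\<in>A - {i}. z - x j))"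
    by (simp add: poly_sum poly_prod)
  also have "\<dots> = (\<Sum>i\<in>A. - (poly p (x i) / ((x i - z) * (\<Prod>j\<in>A - {i}. x i - x j)) * (\<Prod>i\<in>A. z - x i)))"
  proof (rule sum.cong[OF refl])
    fix i assume i: "i \<in> A"
    have eq: "(\<Prod>j\<in>A. z - x j) = - (x i - z) * (\<Prod>j\<in>A - {i}. z - x j)"
      using A i by (simp add: prod.remove)
    have cancel: "P / Q * R = - (P / (d * Q) * (- d * R))" if "d \<noteq> 0" for P Q R d :: 'a
      using that by simp
    show "poly p (x i) / (\<Prod>j\<in>A - {i}. x i - x j) * (\<Prod>j\<in>A - {i}. z - x j)
      = - (poly p (x i) / ((x i - z) * (\<Prod>j\<in>A - {i}. x i - x j)) * (\<Prod>i\<in>A. z - x i))"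
      unfolding eq by (rule cancel) (use z[OF i] in simp)
  qed
  also have "\<dots> = - (\<Sum>i\<in>A. poly p (x i) / ((x i - z) * (\<Prod>j\<in>A - {i}. x i - x j))) * (\<Prod>i\<in>A. z - x i)"
    by (simp add: sum_negf sum_distrib_right)
  finally show ?thesis using nz by (simp add: field_simps)
qed

text \<open>Comparison of leading coefficients when the monomial of degree \<open>card A - 1\<close>
  is interpolated.\<close>

lemma sum_power_div_prod_diff:
  fixes x :: "'i \<Rightarrow> 'a :: field"
  assumes A: "finite A" "A \<noteq> {}" and inj: "inj_on x A"
  shows "(\<Sum>i\<in>A. x i ^ (card A - 1) / (\<Prod>j\<in>A - {i}. x i - x j)) = 1"
proof -
  let ?p = "monom 1 (card A - 1) :: 'a poly"
  have "degree ?p < card A" using A by (simp add: degree_monom_eq card_gt_0_iff)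
  from lagrange_interpolation_poly[OF A(1) inj this]
  have "coeff ?p (card A - 1) = coeff (\<Sum>i\<in>A. smult (poly ?p (x i) / (\<Prod>j\<in>A - {i}. x i - x j))
       (\<Prod>j\<in>A - {i}. [:- x j, 1:])) (card A - 1)" by simp
  also have "\<dots> = (\<Sum>i\<in>A. x i ^ (card A - 1) / (\<Prod>j\<in>A - {i}. x i - x j))"
  proof -
    have "coeff (\<Prod>j\<in>A - {i}. [:- x j, 1:]) (card A - 1) = 1" if "i \<in> A" for i
    proof -
      have "degree (\<Prod>j\<in>A - {i}. [:- x j, 1:]) = card A - 1"
        using A that by (subst degree_prod_eq_sum_degree) (auto simp: card_Diff_singleton)
      moreover have "lead_coeff (\<Prod>j\<in>A - {i}. [:- x j, 1:]) = 1"
        by (simp add: lead_coeff_prod)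
      ultimately show ?thesis by simp
    qed
    thus ?thesis by (simp add: coeff_sum poly_monom)
  qed
  finally show ?thesis by simp
qed

section \<open>Vandermonde and Cauchy--Vandermonde products with their column expansions\<close>

text \<open>The Vandermonde determinant in product form. Arbitrary finite index sets allow the
  minors \<open>A - {i}\<close> to be named without renumbering the rows.\<close>

definition vdm :: "nat set \<Rightarrow> (nat \<Rightarrow> 'a) \<Rightarrow> 'a :: field" where
  "vdm A x = (\<Prod>i\<in>A. \<Prod>j\<in>{j\<in>A. j < i}. x i - x j)"

lemma vdm_empty [simp]: "vdm {} x = 1"
  by (simp add: vdm_def)

text \<open>The indices above \<open>a\<close> contribute x i - x a rather than x a - x i; the sign
  counts them.\<close>

lemma vdm_insert:
  assumes A: "finite A" "a \<notin> A"
  shows "vdm (insert a A) x = (-1) ^ card {j\<in>A. a < j} * (\<Prod>j\<in>A. x a - x j) * vdm A x"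
proof -
  have "(\<Prod>i\<in>A. \<Prod>j\<in>{j\<in>insert a A. j < i}. x i - x j)
      = (\<Prod>i\<in>A. (if a < i then x i - x a else 1) * (\<Prod>j\<in>{j\<in>A. j < i}. x i - x j))"
  proof (rule prod.cong[OF refl])
    fix i assume i: "i \<in> A"
    have "{j \<in> insert a A. j < i} = (if a < i then insert a {j\<in>A. j < i} else {j\<in>A. j < i})"
      by auto
    thus "(\<Prod>j\<in>{j\<in>insert a A. j < i}. x i - x j)
      = (if a < i then x i - x a else 1) * (\<Prod>j\<in>{j\<in>A. j < i}. x i - x j)"
      using A by simp
  qed
  also have "\<dots> = (\<Prod>i\<in>{i\<in>A. a < i}. x i - x a) * vdm A x"
    using A by (simp add: prod.distrib vdm_def prod.inter_filter)
  also have "(\<Prod>i\<in>{i\<in>A. a < i}. x i - x a) = (\<Prod>i\<in>{i\<in>A. a < i}. (-1) * (x a - x i))"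
    by simp
  also have "\<dots> = (-1) ^ card {i\<in>A. a < i} * (\<Prod>i\<in>{i\<in>A. a < i}. x a - x i)"
    by (simp only: prod.distrib prod_constant)
  finally have 1: "(\<Prod>i\<in>A. \<Prod>j\<in>{j\<in>insert a A. j < i}. x i - x j)
     = (-1) ^ card {i\<in>A. a < i} * (\<Prod>i\<in>{i\<in>A. a < i}. x a - x i) * vdm A x" .
  have "vdm (insert a A) x = (\<Prod>j\<in>{j\<in>insert a A. j < a}. x a - x j)
      * (\<Prod>i\<in>A. \<Prod>j\<in>{j\<in>insert a A. j < i}. x i - x j)"
    unfolding vdm_def by (rule prod.insert[OF A])
  also have "{j \<in> insert a A. j < a} = {j \<in> A. j < a}" by auto
  finally have "vdm (insert a A) x = (\<Prod>j\<in>{j\<in>A. j < a}. x a - x j)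
      * (\<Prod>i\<in>A. \<Prod>j\<in>{j\<in>insert a A. j < i}. x i - x j)" .
  moreover have "(\<Prod>j\<in>A. x a - x j) = (\<Prod>j\<in>{j\<in>A. j < a}. x a - x j) * (\<Prod>j\<in>{j\<in>A. a < j}. x a - x j)"
    using A by (subst prod.union_disjoint [symmetric]) (auto intro!: prod.cong, metis nat_neq_iff)
  ultimately show ?thesis by (simp only: 1 mult_ac)
qed

lemma vdm_remove:
  assumes "finite A" "a \<in> A"
  shows "vdm A x = (-1) ^ card {j\<in>A. a < j} * (\<Prod>j\<in>A - {a}. x a - x j) * vdm (A - {a}) x"
proof -
  have "{j \<in> A - {a}. a < j} = {j \<in> A. a < j}" by auto
  thus ?thesis using vdm_insert[of "A - {a}" a x] assms by (simp add: insert_absorb)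
qed

lemma vdm_cong: "(\<And>i. i \<in> A \<Longrightarrow> x i = x' i) \<Longrightarrow> vdm A x = vdm A x'"
  by (auto simp: vdm_def intro!: prod.cong)

lemma vdm_nonzero: "finite A \<Longrightarrow> inj_on x A \<Longrightarrow> vdm A x \<noteq> 0"
  by (auto simp: vdm_def inj_on_def)

text \<open>Laplace expansion along the column of highest powers, obtained without determinants:
  divided by \<open>vdm A x\<close>, the summands are those of
  \<open>sum_power_div_prod_diff\<close>, which add up to 1.\<close>

lemma vdm_expand:
  fixes x :: "nat \<Rightarrow> 'a :: field"
  assumes A: "finite A" "A \<noteq> {}" and inj: "inj_on x A"
  shows "vdm A x = (\<Sum>i\<in>A. (-1) ^ card {j\<in>A. i < j} * (x i ^ (card A - 1) * vdm (A - {i}) x))"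
proof -
  have "vdm A x * (x i ^ (card A - 1) / (\<Prod>j\<in>A - {i}. x i - x j))
      = (-1) ^ card {j\<in>A. i < j} * (x i ^ (card A - 1) * vdm (A - {i}) x)" if "i \<in> A" for i
  proof -
    have "(\<Prod>j\<in>A - {i}. x i - x j) \<noteq> 0" using A inj that by (auto simp: inj_on_def)
    thus ?thesis using vdm_remove[OF A(1) that, of x] by (simp add: field_simps)
  qed
  hence "(\<Sum>i\<in>A. (-1) ^ card {j\<in>A. i < j} * (x i ^ (card A - 1) * vdm (A - {i}) x))
      = vdm A x * (\<Sum>i\<in>A. x i ^ (card A - 1) / (\<Prod>j\<in>A - {i}. x i - x j))"
    by (simp add: sum_distrib_left)
  thus ?thesis using sum_power_div_prod_diff[OF A inj] by simp
qed

text \<open>Up to sign, the determinant with Cauchy columns \<open>1 / (x\<^sub>i - y\<^sub>j)\<close>, \<open>j \<in> B\<close>, and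
  \<open>card A - card B\<close> Vandermonde columns \<open>1, x\<^sub>i, x\<^sub>i\<^sup>2, \<dots>\<close>.\<close>
definition cauchy_vdm :: "nat set \<Rightarrow> nat set \<Rightarrow> (nat \<Rightarrow> 'a) \<Rightarrow> (nat \<Rightarrow> 'a) \<Rightarrow> 'a :: field" where
  "cauchy_vdm A B x y = vdm A x * vdm B y / (\<Prod>i\<in>A. \<Prod>j\<in>B. x i - y j)"

lemma cauchy_vdm_cong:
  "(\<And>i. i \<in> A \<Longrightarrow> x i = x' i) \<Longrightarrow> (\<And>j. j \<in> B \<Longrightarrow> y j = y' j) \<Longrightarrow>
     cauchy_vdm A B x y = cauchy_vdm A B x' y'"
  using vdm_cong[of A x x'] vdm_cong[of B y y'] by (simp add: cauchy_vdm_def)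

text \<open>Laplace expansion along the Cauchy column of \<open>b\<close>. After division by
  \<open>cauchy_vdm A B x y\<close> it becomes the partial fraction expansion of the polynomial with
  roots \<open>y j\<close>, \<open>j \<in> B\<close>, whose degree is below \<open>card A\<close>.
  Taking \<open>b\<close> above all of \<open>B\<close> avoids a sign in
  \<open>vdm_insert\<close>.\<close>

lemma cauchy_vdm_expand:
  fixes x y :: "nat \<Rightarrow> 'a :: field"
  assumes A: "finite A" and inj: "inj_on x A" and B: "finite B" "card B < card A"
    and b: "\<And>j. j \<in> B \<Longrightarrow> j < b"
    and xy: "\<And>i j. i \<in> A \<Longrightarrow> j \<in> insert b B \<Longrightarrow> x i \<noteq> y j"
  shows "cauchy_vdm A (insert b B) x y
    = (\<Sum>i\<in>A. - ((-1) ^ card A) * (-1) ^ card {j\<in>A. i < j} * (1 / (x i - y b) * cauchy_vdm (A - {i}) B x y))"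
proof -
  define p where "p = (\<Prod>j\<in>B. [:- y j, 1:])"
  have deg: "degree p < card A"
    unfolding p_def using B by (subst degree_prod_eq_sum_degree) auto
  have p: "poly p z = (\<Prod>j\<in>B. z - y j)" for z by (simp add: p_def poly_prod)
  have bB: "b \<notin> B" using b by blast
  have "{j\<in>B. b < j} = {}" using b by (auto dest: less_trans)
  hence vb: "vdm (insert b B) y = poly p (y b) * vdm B y"
    using vdm_insert[OF B(1) bB, of y] by (simp only: p card.empty power_0 mult_1_left)
  have summand: "(-1) ^ card {j\<in>A. i < j} * (1 / (x i - y b) * cauchy_vdm (A - {i}) B x y)
      = cauchy_vdm A B x y * (poly p (x i) / ((x i - y b) * (\<Prod>j\<in>A - {i}. x i - x j)))" if i: "i \<in> A" for i
  proof -
    have 1: "(\<Prod>j\<in>A - {i}. x i - x j) \<noteq> 0" using A inj i by (auto simp: inj_on_def)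
    have 2: "(\<Prod>i\<in>A. \<Prod>j\<in>B. x i - y j) = poly p (x i) * (\<Prod>i\<in>A - {i}. \<Prod>j\<in>B. x i - y j)"
      using A i by (simp add: prod.remove p)
    have 3: "poly p (x i) \<noteq> 0" using xy i B by (auto simp: p)
    have 4: "(\<Prod>i\<in>A - {i}. \<Prod>j\<in>B. x i - y j) \<noteq> 0" using xy A B by auto
    have cancel: "e * (1 / d * (V * W / R)) = e * Q * V * W / (P * R) * (P / (d * Q))"
      if "Q \<noteq> 0" "P \<noteq> 0" "R \<noteq> 0" "d \<noteq> 0" for e d V W R Q P :: 'a
      using that by (simp add: field_simps)
    show ?thesis
      unfolding cauchy_vdm_def 2 vdm_remove[OF A i, of x]
      by (rule cancel) (use 1 3 4 xy[OF i, of b] in auto)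
  qed
  have "(\<Sum>i\<in>A. - ((-1) ^ card A) * (-1) ^ card {j\<in>A. i < j} * (1 / (x i - y b) * cauchy_vdm (A - {i}) B x y))
      = - ((-1) ^ card A) * cauchy_vdm A B x y
          * (\<Sum>i\<in>A. poly p (x i) / ((x i - y b) * (\<Prod>j\<in>A - {i}. x i - x j)))"
    unfolding sum_distrib_left by (rule sum.cong[OF refl]) (simp only: summand mult.assoc)
  also have "\<dots> = (-1) ^ card A * cauchy_vdm A B x y * (poly p (y b) / (\<Prod>i\<in>A. y b - x i))"
    using xy by (subst partial_fraction_sum[OF A inj deg]) auto
  \<comment> \<open>Reversing these differences produces a second sign that cancels the
    prefactor.\<close>
  also have "(\<Prod>i\<in>A. y b - x i) = (\<Prod>i\<in>A. (-1) * (x i - y b))" by simp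
  also have "\<dots> = (-1) ^ card A * (\<Prod>i\<in>A. x i - y b)"
    by (simp only: prod.distrib prod_constant)
  also have "(-1) ^ card A * cauchy_vdm A B x y * (poly p (y b) / ((-1) ^ card A * (\<Prod>i\<in>A. x i - y b)))
      = cauchy_vdm A (insert b B) x y"
    using bB B(1) by (simp add: cauchy_vdm_def vb prod.distrib mult_ac)
  finally show ?thesis by simp
qed

section \<open>Subset sums of shifted determinants\<close>

text \<open>In the exponential variables this will be a translation of x by \<rho> up to sign. It
  differs from the imaginary step of the difference operators, which acts only on the kernel
  function.\<close>

definition qshift :: "'a \<Rightarrow> nat set \<Rightarrow> (nat \<Rightarrow> 'a) \<Rightarrow> nat \<Rightarrow> 'a :: field" where
  "qshift q I x j = (if j \<in> I then q * x j else x j)"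

lemma sum_Pow_remove:
  fixes g :: "'i set \<Rightarrow> 'a :: comm_monoid_add"
  assumes "finite A" "i \<in> A"
  shows "(\<Sum>I\<in>Pow A. g I) = (\<Sum>I\<in>Pow (A - {i}). g I + g (insert i I))"
proof -
  have "Pow A = Pow (A - {i}) \<union> insert i ` Pow (A - {i})"
    using assms by (metis Pow_insert insert_Diff)
  moreover have "inj_on (insert i) (Pow (A - {i}))" by (auto simp: inj_on_def)
  moreover have "Pow (A - {i}) \<inter> insert i ` Pow (A - {i}) = {}" by auto
  ultimately show ?thesis using assms
    by (simp add: sum.union_disjoint sum.reindex sum.distrib)
qed

text \<open>The sum over subsets is the product of all 1 + v T_i applied to \<Phi>. If \<Phi>
  expands along a column with entries f (x i), and the i-th minor does not involve x i, then 1 + v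
  T_i meets only the entry and the other factors act on the minor. Vandermonde and Cauchy columns
  are both treated this way.\<close>

lemma sum_Pow_shift_expand:
  fixes \<Phi> :: "(nat \<Rightarrow> 'a :: field) \<Rightarrow> 'a" and \<Phi>' :: "nat \<Rightarrow> (nat \<Rightarrow> 'a) \<Rightarrow> 'a"
  assumes A: "finite A"
    and expand: "\<And>I. I \<subseteq> A \<Longrightarrow>
      \<Phi> (qshift q I x) = (\<Sum>i\<in>A. e i * (f (qshift q I x i) * \<Phi>' i (qshift q I x)))"
    and cong: "\<And>i I. i \<in> A \<Longrightarrow> \<Phi>' i (qshift q (insert i I) x) = \<Phi>' i (qshift q I x)"
  shows "(\<Sum>I\<in>Pow A. v ^ card I * \<Phi> (qshift q I x))
     = (\<Sum>i\<in>A. e i * ((f (x i) + v * f (q * x i)) * (\<Sum>I\<in>Pow (A - {i}). v ^ card I * \<Phi>' i (qshift q I x))))"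
proof -
  have "(\<Sum>I\<in>Pow A. v ^ card I * \<Phi> (qshift q I x))
      = (\<Sum>I\<in>Pow A. \<Sum>i\<in>A. v ^ card I * (e i * (f (qshift q I x i) * \<Phi>' i (qshift q I x))))"
    using expand by (simp add: sum_distrib_left)
  also have "\<dots> = (\<Sum>i\<in>A. \<Sum>I\<in>Pow A. v ^ card I * (e i * (f (qshift q I x i) * \<Phi>' i (qshift q I x))))"
    by (rule sum.swap)
  also have "\<dots> = (\<Sum>i\<in>A. \<Sum>I\<in>Pow (A - {i}). e i * ((f (x i) + v * f (q * x i)) * (v ^ card I * \<Phi>' i (qshift q I x))))"
  proof (rule sum.cong[OF refl])
    fix i assume i: "i \<in> A"
    show "(\<Sum>I\<in>Pow A. v ^ card I * (e i * (f (qshift q I x i) * \<Phi>' i (qshift q I x))))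
        = (\<Sum>I\<in>Pow (A - {i}). e i * ((f (x i) + v * f (q * x i)) * (v ^ card I * \<Phi>' i (qshift q I x))))"
      unfolding sum_Pow_remove[OF A i]
    proof (rule sum.cong[OF refl])
      fix I assume I: "I \<in> Pow (A - {i})"
      hence "card (insert i I) = Suc (card I)" using A
        by (subst card_insert_disjoint) (auto dest: finite_subset)
      moreover have "qshift q I x i = x i" "qshift q (insert i I) x i = q * x i"
        using I by (auto simp: qshift_def)
      ultimately show "v ^ card I * (e i * (f (qshift q I x i) * \<Phi>' i (qshift q I x)))
         + v ^ card (insert i I) * (e i * (f (qshift q (insert i I) x i) * \<Phi>' i (qshift q (insert i I) x)))
         = e i * ((f (x i) + v * f (q * x i)) * (v ^ card I * \<Phi>' i (qshift q I x)))"
        using cong[OF i] by (simp add: algebra_simps)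
    qed
  qed
  also have "\<dots> = (\<Sum>i\<in>A. e i * ((f (x i) + v * f (q * x i)) * (\<Sum>I\<in>Pow (A - {i}). v ^ card I * \<Phi>' i (qshift q I x))))"
    by (simp add: sum_distrib_left)
  finally show ?thesis .
qed

text \<open>Distinctness that survives \<open>qshift q I\<close> for every \<open>I\<close>: two
  points must differ whether both, one or none of them is scaled.\<close>

definition q_generic :: "'a :: field \<Rightarrow> nat set \<Rightarrow> (nat \<Rightarrow> 'a) \<Rightarrow> bool" where
  "q_generic q A x \<longleftrightarrow> q \<noteq> 0 \<and> inj_on x A \<and> (\<forall>i\<in>A. \<forall>j\<in>A. i \<noteq> j \<longrightarrow> q * x i \<noteq> x j)"

lemma q_generic_subset: "q_generic q A x \<Longrightarrow> B \<subseteq> A \<Longrightarrow> q_generic q B x"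
  by (auto simp: q_generic_def intro: inj_on_subset)

lemma inj_on_qshift: "q_generic q A x \<Longrightarrow> inj_on (qshift q I x) A"
proof (rule inj_onI, rule ccontr)
  fix i j assume "q_generic q A x" "i \<in> A" "j \<in> A" "qshift q I x i = qshift q I x j" "i \<noteq> j"
  moreover from this have "q \<noteq> 0" "x i \<noteq> x j" "q * x i \<noteq> x j" "q * x j \<noteq> x i"
    by (auto simp: q_generic_def inj_on_def)
  ultimately show False by (auto simp: qshift_def split: if_splits)
qed

text \<open>The operator 1 + v T multiplies the column of n-th powers by 1 + v q^n. Induction strips
  off the highest column and leaves smaller Vandermonde products.\<close>

lemma sum_qshift_vdm:
  fixes x :: "nat \<Rightarrow> 'a :: field"
  assumes "finite A" "q_generic q A x"
  shows "(\<Sum>I\<in>Pow A. v ^ card I * vdm A (qshift q I x)) = (\<Prod>p<card A. 1 + v * q ^ p) * vdm A x"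
  using assms
proof (induction "card A" arbitrary: A)
  case 0
  thus ?case by simp
next
  case (Suc n)
  have ne: "A \<noteq> {}" and n: "card A - 1 = n" using Suc by auto
  have "(\<Sum>I\<in>Pow A. v ^ card I * vdm A (qshift q I x))
      = (\<Sum>i\<in>A. (-1) ^ card {j\<in>A. i < j} * ((x i ^ n + v * (q * x i) ^ n)
           * (\<Sum>I\<in>Pow (A - {i}). v ^ card I * vdm (A - {i}) (qshift q I x))))"
  proof (rule sum_Pow_shift_expand)
    show "vdm A (qshift q I x) = (\<Sum>i\<in>A. (-1) ^ card {j\<in>A. i < j}
        * (qshift q I x i ^ n * vdm (A - {i}) (qshift q I x)))" for I
      using vdm_expand[OF Suc.prems(1) ne inj_on_qshift[OF Suc.prems(2), of I]] by (simp only: n)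
    show "vdm (A - {i}) (qshift q (insert i I) x) = vdm (A - {i}) (qshift q I x)" for i I
      by (rule vdm_cong) (auto simp: qshift_def)
  qed (use Suc in auto)
  also have "\<dots> = (\<Sum>i\<in>A. (-1) ^ card {j\<in>A. i < j} * ((x i ^ n + v * (q * x i) ^ n)
           * ((\<Prod>p<n. 1 + v * q ^ p) * vdm (A - {i}) x)))"
  proof (rule sum.cong[OF refl])
    fix i assume i: "i \<in> A"
    hence "n = card (A - {i})" using n Suc.prems by simp
    from Suc.hyps(1)[OF this] this
    show "(-1) ^ card {j\<in>A. i < j} * ((x i ^ n + v * (q * x i) ^ n)
           * (\<Sum>I\<in>Pow (A - {i}). v ^ card I * vdm (A - {i}) (qshift q I x)))
       = (-1) ^ card {j\<in>A. i < j} * ((x i ^ n + v * (q * x i) ^ n)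
           * ((\<Prod>p<n. 1 + v * q ^ p) * vdm (A - {i}) x))"
      using Suc.prems q_generic_subset[of q A x "A - {i}"] by auto
  qed
  also have "\<dots> = (\<Prod>p<Suc n. 1 + v * q ^ p) * (\<Sum>i\<in>A. (-1) ^ card {j\<in>A. i < j} * (x i ^ n * vdm (A - {i}) x))"
    by (simp add: sum_distrib_left power_mult_distrib algebra_simps)
  also have "(\<Sum>i\<in>A. (-1) ^ card {j\<in>A. i < j} * (x i ^ n * vdm (A - {i}) x)) = vdm A x"
    using vdm_expand[OF Suc.prems(1) ne, of x] Suc.prems(2) by (simp only: n q_generic_def)
  finally show ?case using Suc.hyps(2) by simp
qed

text \<open>Induction removes the largest element of \<open>B\<close> together with one row, so
  \<open>l\<close> stays fixed and \<open>A\<close> must be arbitrary. In a Cauchy column a shift of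
  the row variable can be traded for the inverse shift of the column variable; once the Cauchy
  columns are used up, the Vandermonde columns give the scalar factor.\<close>

lemma sum_qshift_cauchy_vdm:
  fixes x y :: "nat \<Rightarrow> 'a :: field"
  assumes "finite A" "q_generic q A x" "finite B" "card A = card B + l"
    and "\<And>i j. i \<in> A \<Longrightarrow> j \<in> B \<Longrightarrow> x i \<noteq> y j" "\<And>i j. i \<in> A \<Longrightarrow> j \<in> B \<Longrightarrow> q * x i \<noteq> y j"
  shows "(\<Sum>I\<in>Pow A. v ^ card I * cauchy_vdm A B (qshift q I x) y)
    = (\<Prod>p<l. 1 + v * q ^ p) * (\<Sum>J\<in>Pow B. (v / q) ^ card J * cauchy_vdm A B x (qshift (1 / q) J y))"
  using assms(3,1,2,4-)
proof (induction B arbitrary: A rule: finite_linorder_max_induct)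
  case empty
  thus ?case using sum_qshift_vdm[of A q x v] by (simp add: cauchy_vdm_def)
next
  case (insert b B)
  have bB: "b \<notin> B" using insert.hyps by blast
  have cardA: "card B < card A" using insert.hyps insert.prems bB by simp
  have q: "q \<noteq> 0" using insert.prems by (auto simp: q_generic_def)
  define e where "e = (\<lambda>i. - ((-1) ^ card A) * (-1) ^ card {j\<in>A. i < j} :: 'a)"
  define S where "S = (\<lambda>i. \<Sum>J\<in>Pow B. (v / q) ^ card J * cauchy_vdm (A - {i}) B x (qshift (1 / q) J y))"
  have "(\<Sum>I\<in>Pow A. v ^ card I * cauchy_vdm A (insert b B) (qshift q I x) y)
     = (\<Sum>i\<in>A. e i * ((1 / (x i - y b) + v * (1 / (q * x i - y b)))
          * (\<Sum>I\<in>Pow (A - {i}). v ^ card I * cauchy_vdm (A - {i}) B (qshift q I x) y)))"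
  proof (rule sum_Pow_shift_expand)
    show "cauchy_vdm A (insert b B) (qshift q I x) y
       = (\<Sum>i\<in>A. e i * (1 / (qshift q I x i - y b) * cauchy_vdm (A - {i}) B (qshift q I x) y))" for I
      unfolding e_def using insert.hyps insert.prems cardA
      by (intro cauchy_vdm_expand inj_on_qshift) (auto simp: qshift_def)
    show "cauchy_vdm (A - {i}) B (qshift q (insert i I) x) y = cauchy_vdm (A - {i}) B (qshift q I x) y" for i I
      by (rule cauchy_vdm_cong) (auto simp: qshift_def)
  qed (use insert.hyps insert.prems in auto)
  also have "\<dots> = (\<Sum>i\<in>A. e i * ((1 / (x i - y b) + v * (1 / (q * x i - y b))) * ((\<Prod>p<l. 1 + v * q ^ p) * S i)))"
  proof (rule sum.cong[OF refl])
    fix i assume i: "i \<in> A"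
    have "(\<Sum>I\<in>Pow (A - {i}). v ^ card I * cauchy_vdm (A - {i}) B (qshift q I x) y) = (\<Prod>p<l. 1 + v * q ^ p) * S i"
      unfolding S_def
    proof (rule insert.IH)
      show "card (A - {i}) = card B + l" using insert.hyps insert.prems i bB by simp
      show "q_generic q (A - {i}) x" using insert.prems(2) by (rule q_generic_subset) auto
    qed (use insert.hyps insert.prems in auto)
    thus "e i * ((1 / (x i - y b) + v * (1 / (q * x i - y b)))
          * (\<Sum>I\<in>Pow (A - {i}). v ^ card I * cauchy_vdm (A - {i}) B (qshift q I x) y))
      = e i * ((1 / (x i - y b) + v * (1 / (q * x i - y b))) * ((\<Prod>p<l. 1 + v * q ^ p) * S i))"
      by simp
  qed
  also have "\<dots> = (\<Prod>p<l. 1 + v * q ^ p)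
     * (\<Sum>i\<in>A. e i * ((1 / (x i - y b) + v * (1 / (q * x i - y b))) * S i))"
    by (simp add: sum_distrib_left mult_ac)
  also have "(\<Sum>i\<in>A. e i * ((1 / (x i - y b) + v * (1 / (q * x i - y b))) * S i))
     = (\<Sum>J\<in>Pow (insert b B). (v / q) ^ card J * cauchy_vdm A (insert b B) x (qshift (1 / q) J y))"
  proof -
    \<comment> \<open>The same expansion is read backwards: with the column variables shifted, it
      reassembles the full products from the minors.\<close>
    have exp: "cauchy_vdm A (insert b B) x (qshift (1 / q) J y)
       = (\<Sum>i\<in>A. e i * (1 / (x i - qshift (1 / q) J y b) * cauchy_vdm (A - {i}) B x (qshift (1 / q) J y)))" for J
    proof -
      have "x i \<noteq> qshift (1 / q) J y j" if "i \<in> A" "j \<in> insert b B" for i j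
        using insert.prems that q by (auto simp: qshift_def field_simps)
      thus ?thesis unfolding e_def using insert.hyps insert.prems cardA
        by (intro cauchy_vdm_expand) (auto simp: q_generic_def)
    qed
    have "(\<Sum>J\<in>Pow (insert b B). (v / q) ^ card J * cauchy_vdm A (insert b B) x (qshift (1 / q) J y))
        = (\<Sum>J\<in>Pow B. (v / q) ^ card J * cauchy_vdm A (insert b B) x (qshift (1 / q) J y)
             + (v / q) ^ card (insert b J) * cauchy_vdm A (insert b B) x (qshift (1 / q) (insert b J) y))"
      using insert.hyps bB by (subst sum_Pow_remove[where i = b]) auto
    also have "\<dots> = (\<Sum>J\<in>Pow B. \<Sum>i\<in>A. e i * ((1 / (x i - y b) + v * (1 / (q * x i - y b)))
           * ((v / q) ^ card J * cauchy_vdm (A - {i}) B x (qshift (1 / q) J y))))"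
    proof (rule sum.cong[OF refl])
      fix J assume J: "J \<in> Pow B"
      hence c: "card (insert b J) = Suc (card J)" using bB insert.hyps
        by (subst card_insert_disjoint) (auto dest: finite_subset)
      have s: "qshift (1 / q) J y b = y b" "qshift (1 / q) (insert b J) y b = y b / q"
        using J bB by (auto simp: qshift_def)
      have cg: "cauchy_vdm (A - {i}) B x (qshift (1 / q) (insert b J) y) = cauchy_vdm (A - {i}) B x (qshift (1 / q) J y)" for i
        using bB by (intro cauchy_vdm_cong) (auto simp: qshift_def)
      \<comment> \<open>Here the shift passes from x to y, at the cost of replacing the weight v by
        v / q.\<close>
      have "v / q * (1 / (x i - y b / q)) = v * (1 / (q * x i - y b))" for i
        using q by (simp add: right_diff_distrib)
      moreover have "e * ((a + v * b) * (w * c)) = w * (e * (a * c)) + r * w * (e * (d * c))"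
        if "r * d = v * b" for a b c d e r w :: 'a
        unfolding that [symmetric] by (simp add: algebra_simps)
      ultimately have "e i * ((1 / (x i - y b) + v * (1 / (q * x i - y b))) * ((v / q) ^ card J * cauchy_vdm (A - {i}) B x (qshift (1 / q) J y)))
         = (v / q) ^ card J * (e i * (1 / (x i - y b) * cauchy_vdm (A - {i}) B x (qshift (1 / q) J y)))
           + (v / q) ^ card (insert b J) * (e i * (1 / (x i - y b / q) * cauchy_vdm (A - {i}) B x (qshift (1 / q) J y)))" for i
        unfolding c power_Suc by blast
      thus "(v / q) ^ card J * cauchy_vdm A (insert b B) x (qshift (1 / q) J y)
             + (v / q) ^ card (insert b J) * cauchy_vdm A (insert b B) x (qshift (1 / q) (insert b J) y)
          = (\<Sum>i\<in>A. e i * ((1 / (x i - y b) + v * (1 / (q * x i - y b)))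
           * ((v / q) ^ card J * cauchy_vdm (A - {i}) B x (qshift (1 / q) J y))))"
        unfolding exp s cg by (simp only: sum.distrib sum_distrib_left)
    qed
    also have "\<dots> = (\<Sum>i\<in>A. e i * ((1 / (x i - y b) + v * (1 / (q * x i - y b))) * S i))"
      unfolding S_def by (subst sum.swap) (simp only: sum_distrib_left)
    finally show ?thesis by simp
  qed
  finally show ?case .
qed

section \<open>The source identity\<close>

text \<open>Each pair of indices contributes on its own: a factor q if both are shifted, the
  displayed quotient if exactly one is, and 1 otherwise.\<close>

lemma vdm_qshift:
  fixes x :: "nat \<Rightarrow> 'a :: field"
  assumes "finite A" "inj_on x A"
  shows "vdm A (qshift q I x) = q ^ (card (A \<inter> I) choose 2)
    * (\<Prod>m\<in>A \<inter> I. \<Prod>n\<in>A - I. (q * x m - x n) / (x m - x n)) * vdm A x"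
  using assms
proof (induction A rule: finite_induct)
  case (insert a A)
  let ?r = "\<lambda>m n. (q * x m - x n) / (x m - x n)"
  let ?W = "\<Prod>m\<in>A \<inter> I. \<Prod>n\<in>A - I. ?r m n"
  have ne: "x a \<noteq> x j" if "j \<in> A" for j using insert.prems insert.hyps that by (auto simp: inj_on_def)
  have split: "(\<Prod>j\<in>A. f j) = (\<Prod>j\<in>A \<inter> I. f j) * (\<Prod>j\<in>A - I. f j)" for f :: "nat \<Rightarrow> 'a"
    using insert.hyps by (subst prod.union_disjoint [symmetric]) (auto intro!: prod.cong)
  define D where "D = (\<Prod>j\<in>A. x a - x j)"
  have IH: "vdm A (qshift q I x) = q ^ (card (A \<inter> I) choose 2) * ?W * vdm A x"
    using insert by simp
  have v: "vdm (insert a A) (qshift q I x) = (-1) ^ card {j\<in>A. a < j}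
      * (\<Prod>j\<in>A. qshift q I x a - qshift q I x j) * vdm A (qshift q I x)"
    "vdm (insert a A) x = (-1) ^ card {j\<in>A. a < j} * D * vdm A x"
    by (simp_all only: vdm_insert[OF insert.hyps] D_def)
  show ?case
  proof (cases "a \<in> I")
    case True
    have "(\<Prod>j\<in>A \<inter> I. qshift q I x a - qshift q I x j) = (\<Prod>j\<in>A \<inter> I. q * (x a - x j))"
      using True by (intro prod.cong) (auto simp: qshift_def algebra_simps)
    moreover have "(\<Prod>j\<in>A - I. qshift q I x a - qshift q I x j) = (\<Prod>j\<in>A - I. ?r a j * (x a - x j))"
      using True ne by (intro prod.cong) (auto simp: qshift_def)
    ultimately have "(\<Prod>j\<in>A. qshift q I x a - qshift q I x j) = q ^ card (A \<inter> I) * (\<Prod>n\<in>A - I. ?r a n) * D"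
      unfolding split D_def by (simp only: prod.distrib prod_constant mult_ac)
    moreover have "(\<Prod>m\<in>insert a A \<inter> I. \<Prod>n\<in>insert a A - I. ?r m n) = (\<Prod>n\<in>A - I. ?r a n) * ?W"
    proof -
      have sets: "insert a A \<inter> I = insert a (A \<inter> I)" "insert a A - I = A - I" using True by auto
      have "finite (A \<inter> I)" "a \<notin> A \<inter> I" using insert.hyps by auto
      thus ?thesis unfolding sets by (rule prod.insert)
    qed
    moreover have "card (insert a A \<inter> I) choose 2 = card (A \<inter> I) + (card (A \<inter> I) choose 2)"
    proof -
      have "insert a A \<inter> I = insert a (A \<inter> I)" using True by auto
      hence "card (insert a A \<inter> I) = Suc (card (A \<inter> I))" using insert.hyps by simp
      thus ?thesis by (simp add: numeral_2_eq_2)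
    qed
    ultimately show ?thesis unfolding v IH by (simp only: power_add mult_ac)
  next
    case False
    have "(\<Prod>j\<in>A \<inter> I. qshift q I x a - qshift q I x j) = (\<Prod>j\<in>A \<inter> I. ?r j a * (x a - x j))"
    proof (rule prod.cong[OF refl])
      fix j assume j: "j \<in> A \<inter> I"
      have "u / d * (- d) = - u" if "d \<noteq> 0" for u d :: 'a using that by simp
      from this[of "x j - x a" "q * x j - x a"] ne[of j] j
      have "?r j a * (x a - x j) = x a - q * x j" by simp
      thus "qshift q I x a - qshift q I x j = ?r j a * (x a - x j)"
        using False j by (simp add: qshift_def)
    qed
    moreover have "(\<Prod>j\<in>A - I. qshift q I x a - qshift q I x j) = (\<Prod>j\<in>A - I. x a - x j)"
      using False by (intro prod.cong) (auto simp: qshift_def)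
    ultimately have "(\<Prod>j\<in>A. qshift q I x a - qshift q I x j) = (\<Prod>m\<in>A \<inter> I. ?r m a) * D"
      unfolding split D_def by (simp only: prod.distrib mult_ac)
    moreover have "(\<Prod>m\<in>insert a A \<inter> I. \<Prod>n\<in>insert a A - I. ?r m n) = (\<Prod>m\<in>A \<inter> I. ?r m a) * ?W"
    proof -
      have sets: "insert a A \<inter> I = A \<inter> I" "insert a A - I = insert a (A - I)" using False by auto
      have "finite (A - I)" "a \<notin> A - I" using insert.hyps by auto
      hence "(\<Prod>n\<in>insert a (A - I). ?r m n) = ?r m a * (\<Prod>n\<in>A - I. ?r m n)" for m
        by (rule prod.insert)
      thus ?thesis unfolding sets by (simp only: prod.distrib)
    qed
    moreover have "insert a A \<inter> I = A \<inter> I" using False by auto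
    ultimately show ?thesis unfolding v IH by (simp only: mult_ac)
  qed
qed (simp add: numeral_2_eq_2)

lemma cauchy_vdm_qshift_left:
  fixes x y :: "nat \<Rightarrow> 'a :: field"
  assumes "finite A" "inj_on x A" "I \<subseteq> A" "finite B"
    and ne: "\<And>i j. i \<in> A \<Longrightarrow> j \<in> B \<Longrightarrow> x i \<noteq> y j"
  shows "cauchy_vdm A B (qshift q I x) y = q ^ (card I choose 2)
    * (\<Prod>m\<in>I. \<Prod>n\<in>A - I. (q * x m - x n) / (x m - x n))
    * (\<Prod>m\<in>I. \<Prod>n\<in>B. (x m - y n) / (q * x m - y n)) * cauchy_vdm A B x y"
proof -
  have split: "(\<Prod>j\<in>A. f j) = (\<Prod>j\<in>I. f j) * (\<Prod>j\<in>A - I. f j)" for f :: "nat \<Rightarrow> 'a"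
    using assms by (simp add: prod.subset_diff mult.commute)
  have "(\<Prod>i\<in>A. \<Prod>j\<in>B. qshift q I x i - y j)
      = (\<Prod>i\<in>I. \<Prod>j\<in>B. q * x i - y j) * (\<Prod>i\<in>A - I. \<Prod>j\<in>B. x i - y j)"
    unfolding split by (intro arg_cong2[where f = "(*)"] prod.cong) (auto simp: qshift_def)
  moreover have "(\<Prod>m\<in>I. \<Prod>n\<in>B. x m - y n) \<noteq> 0"
    using finite_subset[OF assms(3,1)] assms by auto
  moreover have "A \<inter> I = I" using assms by auto
  ultimately show ?thesis
    unfolding cauchy_vdm_def vdm_qshift[OF assms(1,2)]
    by (simp add: split[of "\<lambda>i. \<Prod>j\<in>B. x i - y j"] prod_dividef)
qed

lemma cauchy_vdm_qshift_right:
  fixes x y :: "nat \<Rightarrow> 'a :: field"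
  assumes "finite A" "inj_on y B" "J \<subseteq> B" "finite B"
    and ne: "\<And>i j. i \<in> A \<Longrightarrow> j \<in> B \<Longrightarrow> x i \<noteq> y j"
  shows "cauchy_vdm A B x (qshift q J y) = q ^ (card J choose 2)
    * (\<Prod>m\<in>J. \<Prod>n\<in>B - J. (q * y m - y n) / (y m - y n))
    * (\<Prod>m\<in>A. \<Prod>n\<in>J. (x m - y n) / (x m - q * y n)) * cauchy_vdm A B x y"
proof -
  have split: "(\<Prod>j\<in>B. f j) = (\<Prod>j\<in>J. f j) * (\<Prod>j\<in>B - J. f j)" for f :: "nat \<Rightarrow> 'a"
    using assms by (simp add: prod.subset_diff mult.commute)
  have "(\<Prod>i\<in>A. \<Prod>j\<in>B. x i - qshift q J y j)
      = (\<Prod>i\<in>A. \<Prod>j\<in>J. x i - q * y j) * (\<Prod>i\<in>A. \<Prod>j\<in>B - J. x i - y j)"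
    unfolding split prod.distrib by (intro arg_cong2[where f = "(*)"] prod.cong) (auto simp: qshift_def)
  moreover have "(\<Prod>m\<in>A. \<Prod>n\<in>J. x m - y n) \<noteq> 0"
    using finite_subset[OF assms(3,4)] assms by auto
  moreover have "B \<inter> J = J" using assms by auto
  ultimately show ?thesis
    unfolding cauchy_vdm_def vdm_qshift[OF assms(4,2)]
    by (simp add: split[of "\<lambda>j. x _ - y j"] prod.distrib prod_dividef)
qed

section \<open>Generating functions and the source identity in multiplicative variables\<close>

lemma prod_one_plus_mult:
  fixes d :: "'i \<Rightarrow> 'a :: comm_semiring_1"
  assumes "finite P"
  shows "(\<Prod>p\<in>P. 1 + v * d p) = (\<Sum>K\<in>Pow P. v ^ card K * (\<Prod>p\<in>K. d p))"
  using prod_add[OF assms, of "\<lambda>p. v * d p" "\<lambda>_. 1"] by (simp add: prod.distrib add.commute)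

lemma sum_Pow_power_card_eq_poly:
  fixes a :: "'i set \<Rightarrow> 'a :: comm_semiring_1"
  assumes "finite A"
  shows "\<exists>p. (\<forall>v. poly p v = (\<Sum>I\<in>Pow A. v ^ card I * a I)) \<and>
             (\<forall>k. coeff p k = (\<Sum>I | I \<subseteq> A \<and> card I = k. a I))"
proof (intro exI conjI allI)
  let ?p = "\<Sum>I\<in>Pow A. monom (a I) (card I)"
  show "poly ?p v = (\<Sum>I\<in>Pow A. v ^ card I * a I)" for v
    by (simp add: poly_sum poly_monom mult.commute)
  show "coeff ?p k = (\<Sum>I | I \<subseteq> A \<and> card I = k. a I)" for k
  proof -
    have "coeff ?p k = (\<Sum>I\<in>Pow A. if card I = k then a I else 0)" by (simp add: coeff_sum)
    also have "\<dots> = (\<Sum>I\<in>{I \<in> Pow A. card I = k}. a I)" using assms by (subst sum.inter_filter) auto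
    also have "{I \<in> Pow A. card I = k} = {I. I \<subseteq> A \<and> card I = k}" by auto
    finally show ?thesis .
  qed
qed

text \<open>Both sides of the hypothesis are polynomials in v that agree everywhere. A field of
  characteristic 0 is infinite, so the coefficients agree, and the k-th one collects the subsets of
  size k.\<close>

lemma sum_Pow_power_card_coeffs:
  fixes a :: "'i set \<Rightarrow> 'a :: field_char_0"
  assumes fin: "finite A" "finite B" "finite C"
    and eq: "\<And>v. (\<Sum>I\<in>Pow A. v ^ card I * a I)
        = (\<Sum>K\<in>Pow C. v ^ card K * c K) * (\<Sum>J\<in>Pow B. v ^ card J * b J)"
  shows "(\<Sum>I | I \<subseteq> A \<and> card I = k. a I)
     = (\<Sum>j\<le>k. (\<Sum>K | K \<subseteq> C \<and> card K = j. c K) * (\<Sum>J | J \<subseteq> B \<and> card J = k - j. b J))"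
proof -
  obtain pa where pa: "\<And>v. poly pa v = (\<Sum>I\<in>Pow A. v ^ card I * a I)"
    "\<And>k. coeff pa k = (\<Sum>I | I \<subseteq> A \<and> card I = k. a I)"
    using sum_Pow_power_card_eq_poly[OF fin(1), of a] by blast
  obtain pb where pb: "\<And>v. poly pb v = (\<Sum>I\<in>Pow B. v ^ card I * b I)"
    "\<And>k. coeff pb k = (\<Sum>I | I \<subseteq> B \<and> card I = k. b I)"
    using sum_Pow_power_card_eq_poly[OF fin(2), of b] by blast
  obtain pc where pc: "\<And>v. poly pc v = (\<Sum>I\<in>Pow C. v ^ card I * c I)"
    "\<And>k. coeff pc k = (\<Sum>I | I \<subseteq> C \<and> card I = k. c I)"
    using sum_Pow_power_card_eq_poly[OF fin(3), of c] by blast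
  have "poly pa = poly (pc * pb)"
    using eq by (auto simp: fun_eq_iff pa pb pc)
  hence "pa = pc * pb" by (simp add: poly_eq_poly_eq_iff)
  hence "coeff pa k = (\<Sum>j\<le>k. coeff pc j * coeff pb (k - j))" by (simp add: coeff_mult)
  thus ?thesis by (simp add: pa pb pc)
qed

lemma power_choose_2:
  fixes E :: "'a :: comm_monoid_mult"
  shows "(E\<^sup>2) ^ (n choose 2) = E ^ (n * (n - 1))"
proof -
  have "even (n * (n - 1))" by (cases n) auto
  thus ?thesis by (simp add: power_mult [symmetric] choose_two)
qed

text \<open>The coefficient of v^k in \<open>sum_qshift_cauchy_vdm\<close> with q = E^2, after
  division by the unshifted product. The square root E of q makes the quotients symmetric, as the
  hyperbolic sines will require.\<close>

lemma source_identity_multiplicative: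
  fixes X Y :: "nat \<Rightarrow> 'a :: field_char_0" and E :: 'a
  assumes A: "finite A" "A \<noteq> {}" and B: "finite B" and card: "card A = card B + l"
    and gen: "q_generic (E\<^sup>2) A X" and Y: "inj_on Y B"
    and ne: "\<And>i j. i \<in> A \<Longrightarrow> j \<in> B \<Longrightarrow> X i \<noteq> Y j" "\<And>i j. i \<in> A \<Longrightarrow> j \<in> B \<Longrightarrow> E\<^sup>2 * X i \<noteq> Y j"
  shows "(\<Sum>I | I \<subseteq> A \<and> card I = k.
        (\<Prod>m\<in>I. \<Prod>n\<in>A - I. (E * X m - X n / E) / (X m - X n))
          * (\<Prod>m\<in>I. \<Prod>n\<in>B. (X m - Y n) / (E * X m - Y n / E)))
    = (\<Sum>j\<le>k. (\<Sum>K | K \<subseteq> {..<l} \<and> card K = j. \<Prod>p\<in>K. E\<^sup>2 ^ p * E / E ^ l)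
        * (\<Sum>J | J \<subseteq> B \<and> card J = k - j.
            (\<Prod>m\<in>J. \<Prod>n\<in>B - J. (Y m / E - E * Y n) / (Y m - Y n))
          * (\<Prod>m\<in>A. \<Prod>n\<in>J. (X m - Y n) / (E * X m - Y n / E))))"
proof (rule sum_Pow_power_card_coeffs)
  fix v :: 'a
  have E: "E \<noteq> 0" and X: "inj_on X A" using gen by (auto simp: q_generic_def)
  \<comment> \<open>Symmetrising the quotients leaves a power of E^(l - 1) on each side, with
    exponent \<open>card I\<close> or \<open>card J\<close>. The quotient form also covers l = 0,
    where truncated subtraction would give the wrong exponent.\<close>
  define c where "c = E ^ l / E"
  have c: "c \<noteq> 0" using E by (simp add: c_def)
  have cN: "c * E ^ card B * E = E ^ card A" using E by (simp add: c_def card power_add)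
  define wx where "wx = (\<lambda>I. (\<Prod>m\<in>I. \<Prod>n\<in>A - I. (E * X m - X n / E) / (X m - X n))
          * (\<Prod>m\<in>I. \<Prod>n\<in>B. (X m - Y n) / (E * X m - Y n / E)))"
  define wy where "wy = (\<lambda>J. (\<Prod>m\<in>J. \<Prod>n\<in>B - J. (Y m / E - E * Y n) / (Y m - Y n))
          * (\<Prod>m\<in>A. \<Prod>n\<in>J. (X m - Y n) / (E * X m - Y n / E)))"
  define D where "D = cauchy_vdm A B X Y"
  have D: "D \<noteq> 0"
    using A B ne X Y vdm_nonzero[of A X] vdm_nonzero[of B Y] by (auto simp: D_def cauchy_vdm_def)
  have left: "cauchy_vdm A B (qshift (E\<^sup>2) I X) Y = c ^ card I * wx I * D" if I: "I \<subseteq> A" for I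
  proof -
    have fin: "finite I" using I A by (auto dest: finite_subset)
    have cI: "card I + card (A - I) = card A"
      using I A fin by (simp add: card_Diff_subset card_mono)
    have "(\<Prod>m\<in>I. \<Prod>n\<in>A - I. (E\<^sup>2 * X m - X n) / (X m - X n))
        = (\<Prod>m\<in>I. \<Prod>n\<in>A - I. E * ((E * X m - X n / E) / (X m - X n)))"
      using E by (intro prod.cong refl) (simp add: right_diff_distrib power2_eq_square mult.assoc)
    also have "\<dots> = (E ^ card (A - I)) ^ card I * (\<Prod>m\<in>I. \<Prod>n\<in>A - I. (E * X m - X n / E) / (X m - X n))"
      by (simp only: prod.distrib prod_constant)
    finally have 1: "(\<Prod>m\<in>I. \<Prod>n\<in>A - I. (E\<^sup>2 * X m - X n) / (X m - X n)) = \<dots>" .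
    have "(\<Prod>m\<in>I. \<Prod>n\<in>B. (X m - Y n) / (E\<^sup>2 * X m - Y n))
        = (\<Prod>m\<in>I. \<Prod>n\<in>B. 1 / E * ((X m - Y n) / (E * X m - Y n / E)))"
    proof (intro prod.cong refl)
      fix m n
      have "E\<^sup>2 * X m - Y n = E * (E * X m - Y n / E)"
        using E by (simp add: right_diff_distrib power2_eq_square mult.assoc)
      thus "(X m - Y n) / (E\<^sup>2 * X m - Y n) = 1 / E * ((X m - Y n) / (E * X m - Y n / E))" by simp
    qed
    also have "\<dots> = ((1 / E) ^ card B) ^ card I * (\<Prod>m\<in>I. \<Prod>n\<in>B. (X m - Y n) / (E * X m - Y n / E))"
      by (simp only: prod.distrib prod_constant)
    finally have 2: "(\<Prod>m\<in>I. \<Prod>n\<in>B. (X m - Y n) / (E\<^sup>2 * X m - Y n)) = \<dots>" .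
    have exponents: "E ^ (card I * (card I - 1)) * (E ^ card (A - I)) ^ card I * ((1 / E) ^ card B) ^ card I = c ^ card I"
    proof (cases "card I = 0")
      case False
      have "E ^ (card I * (card I - 1)) * (E ^ card (A - I)) ^ card I * E ^ card I = (E ^ card A) ^ card I"
        using False by (simp add: cI [symmetric] power_add [symmetric] power_mult [symmetric])
          (cases "card I"; simp add: algebra_simps)
      also have "\<dots> = c ^ card I * (E ^ card B) ^ card I * E ^ card I"
        by (simp only: cN [symmetric] power_mult_distrib)
      finally show ?thesis using E by (simp add: power_divide power_one_over field_simps)
    qed auto
    have "cauchy_vdm A B (qshift (E\<^sup>2) I X) Y = E ^ (card I * (card I - 1))
        * ((E ^ card (A - I)) ^ card I * (\<Prod>m\<in>I. \<Prod>n\<in>A - I. (E * X m - X n / E) / (X m - X n)))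
        * (((1 / E) ^ card B) ^ card I * (\<Prod>m\<in>I. \<Prod>n\<in>B. (X m - Y n) / (E * X m - Y n / E))) * D"
      unfolding 1 [symmetric] 2 [symmetric] D_def power_choose_2 [symmetric]
      by (rule cauchy_vdm_qshift_left[OF A(1) X I B ne(1)])
    thus ?thesis
      unfolding exponents [symmetric] wx_def by (simp only: mult_ac)
  qed
  have right: "(v / E\<^sup>2) ^ card J * cauchy_vdm A B X (qshift (1 / E\<^sup>2) J Y) = (v * c) ^ card J * wy J * D"
    if J: "J \<subseteq> B" for J
  proof -
    have fin: "finite J" using J B by (auto dest: finite_subset)
    have cJ: "card J + card (B - J) = card B"
      using J B fin by (simp add: card_Diff_subset card_mono)
    have "(\<Prod>m\<in>J. \<Prod>n\<in>B - J. (1 / E\<^sup>2 * Y m - Y n) / (Y m - Y n))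
        = (\<Prod>m\<in>J. \<Prod>n\<in>B - J. 1 / E * ((Y m / E - E * Y n) / (Y m - Y n)))"
      using E by (intro prod.cong refl) (simp add: diff_divide_distrib power2_eq_square)
    also have "\<dots> = ((1 / E) ^ card (B - J)) ^ card J * (\<Prod>m\<in>J. \<Prod>n\<in>B - J. (Y m / E - E * Y n) / (Y m - Y n))"
      by (simp only: prod.distrib prod_constant)
    finally have 1: "(\<Prod>m\<in>J. \<Prod>n\<in>B - J. (1 / E\<^sup>2 * Y m - Y n) / (Y m - Y n)) = \<dots>" .
    have "(\<Prod>m\<in>A. \<Prod>n\<in>J. (X m - Y n) / (X m - 1 / E\<^sup>2 * Y n))
        = (\<Prod>m\<in>A. \<Prod>n\<in>J. E * ((X m - Y n) / (E * X m - Y n / E)))"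
    proof (intro prod.cong refl)
      fix m n
      have "E * X m - Y n / E = E * (X m - 1 / E\<^sup>2 * Y n)"
        using E by (simp add: right_diff_distrib power2_eq_square)
      thus "(X m - Y n) / (X m - 1 / E\<^sup>2 * Y n) = E * ((X m - Y n) / (E * X m - Y n / E))"
        using E by simp
    qed
    also have "\<dots> = (E ^ card J) ^ card A * (\<Prod>m\<in>A. \<Prod>n\<in>J. (X m - Y n) / (E * X m - Y n / E))"
      by (simp only: prod.distrib prod_constant)
    finally have 2: "(\<Prod>m\<in>A. \<Prod>n\<in>J. (X m - Y n) / (X m - 1 / E\<^sup>2 * Y n)) = \<dots>" .
    have exponents: "(1 / E\<^sup>2) ^ card J * ((1 / E) ^ (card J * (card J - 1)) * ((1 / E) ^ card (B - J)) ^ card J * (E ^ card J) ^ card A) = c ^ card J"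
    proof (cases "card J = 0")
      case False
      have "E ^ card J * (E ^ (card J * (card J - 1)) * (E ^ card (B - J)) ^ card J) = (E ^ card B) ^ card J"
        using False by (simp add: cJ [symmetric] power_add [symmetric] power_mult [symmetric])
          (cases "card J"; simp add: algebra_simps)
      moreover have "(E ^ card J) ^ card A = c ^ card J * (E ^ card B) ^ card J * E ^ card J"
        by (simp only: power_mult_distrib [symmetric] cN) (simp add: power_mult [symmetric] mult.commute)
      moreover have "(E\<^sup>2) ^ card J = E ^ card J * E ^ card J"
        by (simp add: power2_eq_square power_mult_distrib)
      moreover have "1 / (e * e) * (1 / a * (1 / b) * (cc * (e * (a * b)) * e)) = cc"
        if "e \<noteq> 0" "a \<noteq> 0" "b \<noteq> 0" for e a b cc :: 'a
        using that by (simp add: field_simps)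
      ultimately show ?thesis using E by (simp add: power_one_over)
    qed auto
    have ch: "(1 / E) ^ (card J * (card J - 1)) = (1 / E\<^sup>2) ^ (card J choose 2)"
      using power_choose_2[of "1 / E"] by (simp add: power_divide)
    have "cauchy_vdm A B X (qshift (1 / E\<^sup>2) J Y) = (1 / E) ^ (card J * (card J - 1))
        * (((1 / E) ^ card (B - J)) ^ card J * (\<Prod>m\<in>J. \<Prod>n\<in>B - J. (Y m / E - E * Y n) / (Y m - Y n)))
        * ((E ^ card J) ^ card A * (\<Prod>m\<in>A. \<Prod>n\<in>J. (X m - Y n) / (E * X m - Y n / E))) * D"
      unfolding 1 [symmetric] 2 [symmetric] D_def ch
      by (rule cauchy_vdm_qshift_right[OF A(1) Y J B ne(1)])
    moreover have "(v / E\<^sup>2) ^ card J = v ^ card J * (1 / E\<^sup>2) ^ card J"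
      by (simp add: power_divide)
    ultimately show ?thesis
      unfolding power_mult_distrib exponents [symmetric] wy_def by (simp only: mult_ac)
  qed
  \<comment> \<open>Using v / c as the generating variable absorbs these powers on both sides and
    turns the weights q^p into E^(2 p + 1 - l).\<close>
  have "(\<Sum>I\<in>Pow A. v ^ card I * wx I) * D = (\<Sum>I\<in>Pow A. (v / c) ^ card I * cauchy_vdm A B (qshift (E\<^sup>2) I X) Y)"
    using c by (simp add: left sum_distrib_left power_divide mult_ac)
  also have "\<dots> = (\<Prod>p<l. 1 + v / c * (E\<^sup>2) ^ p)
      * (\<Sum>J\<in>Pow B. (v / c / E\<^sup>2) ^ card J * cauchy_vdm A B X (qshift (1 / E\<^sup>2) J Y))"
    using A B card gen ne by (intro sum_qshift_cauchy_vdm) auto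
  also have "(\<Prod>p<l. 1 + v / c * (E\<^sup>2) ^ p) = (\<Prod>p<l. 1 + v * (E\<^sup>2 ^ p * E / E ^ l))"
    by (simp add: c_def mult_ac)
  also have "\<dots> = (\<Sum>K\<in>Pow {..<l}. v ^ card K * (\<Prod>p\<in>K. E\<^sup>2 ^ p * E / E ^ l))"
    by (rule prod_one_plus_mult) simp
  also have "(\<Sum>J\<in>Pow B. (v / c / E\<^sup>2) ^ card J * cauchy_vdm A B X (qshift (1 / E\<^sup>2) J Y))
      = (\<Sum>J\<in>Pow B. v ^ card J * wy J) * D"
  proof -
    have "(v / c / E\<^sup>2) ^ card J * cauchy_vdm A B X (qshift (1 / E\<^sup>2) J Y) = v ^ card J * wy J * D"
      if "J \<in> Pow B" for J
    proof -
      have "(v / c / E\<^sup>2) ^ card J * cauchy_vdm A B X (qshift (1 / E\<^sup>2) J Y)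
          = (1 / c) ^ card J * ((v / E\<^sup>2) ^ card J * cauchy_vdm A B X (qshift (1 / E\<^sup>2) J Y))"
        by (simp add: power_divide power_mult_distrib)
      also have "\<dots> = v ^ card J * wy J * D"
        using that c by (subst right) (auto simp: power_mult_distrib power_one_over)
      finally show ?thesis .
    qed
    thus ?thesis by (simp add: sum_distrib_right)
  qed
  finally have "(\<Sum>I\<in>Pow A. v ^ card I * wx I) * D
      = (\<Sum>K\<in>Pow {..<l}. v ^ card K * (\<Prod>p\<in>K. E\<^sup>2 ^ p * E / E ^ l)) * (\<Sum>J\<in>Pow B. v ^ card J * wy J) * D"
    by (simp add: mult.assoc)
  hence "(\<Sum>I\<in>Pow A. v ^ card I * wx I)
      = (\<Sum>K\<in>Pow {..<l}. v ^ card K * (\<Prod>p\<in>K. E\<^sup>2 ^ p * E / E ^ l)) * (\<Sum>J\<in>Pow B. v ^ card J * wy J)"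
    using D by simp
  thus "(\<Sum>I\<in>Pow A. v ^ card I * ((\<Prod>m\<in>I. \<Prod>n\<in>A - I. (E * X m - X n / E) / (X m - X n))
          * (\<Prod>m\<in>I. \<Prod>n\<in>B. (X m - Y n) / (E * X m - Y n / E))))
      = (\<Sum>K\<in>Pow {..<l}. v ^ card K * (\<Prod>p\<in>K. E\<^sup>2 ^ p * E / E ^ l))
        * (\<Sum>J\<in>Pow B. v ^ card J * ((\<Prod>m\<in>J. \<Prod>n\<in>B - J. (Y m / E - E * Y n) / (Y m - Y n))
          * (\<Prod>m\<in>A. \<Prod>n\<in>J. (X m - Y n) / (E * X m - Y n / E))))"
    by (simp only: wx_def wy_def)
qed (use A B in auto)

section \<open>From multiplicative variables to hyperbolic functions\<close>

lemma sinh_diff_plus_exp: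
  fixes a b c :: complex
  shows "sinh (a - b + c) * (2 * exp a * exp b) = exp c * exp (2 * a) - exp (2 * b) / exp c"
proof -
  have "sinh (a - b + c) = (exp a / exp b * exp c - exp b / exp a / exp c) / 2"
    by (simp add: sinh_field_def exp_add exp_diff exp_minus field_simps)
  moreover have "exp (2 * z) = exp z * exp z" for z :: complex
    by (simp add: exp_double power2_eq_square)
  ultimately show ?thesis by (simp only:) (simp add: field_simps)
qed

text \<open>Numerator and denominator are multiplied by the same nonzero factor, so the equation
  also holds when the denominators vanish.\<close>

lemma sinh_ratio_exp:
  fixes a b c d :: complex
  shows "sinh (a - b + c) / sinh (a - b + d)
    = (exp c * exp (2 * a) - exp (2 * b) / exp c) / (exp d * exp (2 * a) - exp (2 * b) / exp d)"
proof -
  show ?thesis unfolding sinh_diff_plus_exp [symmetric] by simp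
qed

lemma sinh_diff_plus_eq_0_iff:
  fixes a b c :: complex
  shows "sinh (a - b + c) = 0 \<longleftrightarrow> (exp c)\<^sup>2 * exp (2 * a) = exp (2 * b)"
proof -
  have "sinh (a - b + c) = 0 \<longleftrightarrow> sinh (a - b + c) * (2 * exp a * exp b) = 0" by simp
  also have "\<dots> \<longleftrightarrow> (exp c)\<^sup>2 * exp (2 * a) = exp (2 * b)"
    unfolding sinh_diff_plus_exp by (simp add: field_simps power2_eq_square)
  finally show ?thesis .
qed

lemma cosh_conv_sinh_shift: "cosh (z :: complex) = - \<i> * sinh (z + \<i> * of_real (pi / 2))"
proof -
  have "exp (\<i> * of_real (pi / 2)) = \<i>" by (simp only: cis_conv_exp [symmetric] cis_pi_half)
  moreover have "sinh (z + c) = (exp z * exp c - 1 / (exp z * exp c)) / 2" for c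
    by (simp add: sinh_field_def exp_add exp_minus exp_diff divide_simps)
  ultimately have s: "sinh (z + \<i> * of_real (pi / 2)) = (exp z * \<i> - 1 / (exp z * \<i>)) / 2"
    by (simp only:)
  have c: "cosh z = (exp z + 1 / exp z) / 2"
    by (simp add: cosh_field_def exp_minus divide_simps)
  show ?thesis unfolding s c by (simp add: field_simps)
qed

text \<open>The previous identity with X = exp (2 \<alpha> x) and E = exp (\<alpha> r). The
  nonvanishing assumptions are exactly the distinctness conditions on X and Y. The constant \<kappa>
  is absorbed into y.\<close>

lemma source_identity_hyperbolic:
  fixes \<alpha> r :: complex and x y :: "nat \<Rightarrow> complex"
  assumes N: "N \<ge> 1" and l: "l \<le> N"
    and x: "\<And>m n. m \<in> {1..N} \<Longrightarrow> n \<in> {1..N} \<Longrightarrow> m \<noteq> n \<Longrightarrow> sinh (\<alpha> * (x m - x n)) \<noteq> 0"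
    and xr: "\<And>m n. m \<in> {1..N} \<Longrightarrow> n \<in> {1..N} \<Longrightarrow> m \<noteq> n \<Longrightarrow> sinh (\<alpha> * (x m - x n + r)) \<noteq> 0"
    and y: "\<And>m n. m \<in> {1..N - l} \<Longrightarrow> n \<in> {1..N - l} \<Longrightarrow> m \<noteq> n \<Longrightarrow> sinh (\<alpha> * (y m - y n)) \<noteq> 0"
    and xy: "\<And>m n. m \<in> {1..N} \<Longrightarrow> n \<in> {1..N - l} \<Longrightarrow> cosh (\<alpha> * (x m - y n - \<kappa>)) \<noteq> 0"
    and xyr: "\<And>m n. m \<in> {1..N} \<Longrightarrow> n \<in> {1..N - l} \<Longrightarrow> cosh (\<alpha> * (x m - y n - \<kappa> + r)) \<noteq> 0"
  shows "(\<Sum>I | I \<subseteq> {1..N} \<and> card I = k.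
        (\<Prod>m\<in>I. \<Prod>n\<in>{1..N} - I. sinh (\<alpha> * (x m - x n + r)) / sinh (\<alpha> * (x m - x n)))
          * (\<Prod>m\<in>I. \<Prod>n\<in>{1..N - l}. cosh (\<alpha> * (x m - y n - \<kappa>)) / cosh (\<alpha> * (x m - y n - \<kappa> + r))))
    = (\<Sum>j\<le>k. (\<Sum>K | K \<subseteq> {..<l} \<and> card K = j. \<Prod>p\<in>K. exp (\<alpha> * ((2 * of_nat p + 1 - of_nat l) * r)))
        * (\<Sum>J | J \<subseteq> {1..N - l} \<and> card J = k - j.
            (\<Prod>m\<in>J. \<Prod>n\<in>{1..N - l} - J. sinh (\<alpha> * (y m - y n - r)) / sinh (\<alpha> * (y m - y n)))
          * (\<Prod>m\<in>{1..N}. \<Prod>n\<in>J. cosh (\<alpha> * (x m - y n - \<kappa>)) / cosh (\<alpha> * (x m - y n - \<kappa> + r)))))"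
proof -
  \<comment> \<open>The offset \<i> pi / 2 turns cosh into - \<i> sinh, and the constant cancels in
    every quotient.\<close>
  define b where "b = (\<lambda>n. \<alpha> * (y n + \<kappa>) - \<i> * of_real (pi / 2))"
  define E where "E = exp (\<alpha> * r)"
  define X where "X = (\<lambda>m. exp (2 * (\<alpha> * x m)))"
  define Y where "Y = (\<lambda>n. exp (2 * b n))"
  have E: "E \<noteq> 0" by (simp add: E_def)
  have Em: "exp (- (\<alpha> * r)) = 1 / E" by (simp add: E_def exp_minus inverse_eq_divide)
  have x_diff: "\<alpha> * (x m - x n) = \<alpha> * x m - \<alpha> * x n + 0"
    "\<alpha> * (x m - x n + r) = \<alpha> * x m - \<alpha> * x n + \<alpha> * r" for m n
    by (simp_all add: algebra_simps)
  have y_diff: "\<alpha> * (y m - y n) = b m - b n + 0"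
    "\<alpha> * (y m - y n - r) = b m - b n + - (\<alpha> * r)" for m n
    by (simp_all add: b_def algebra_simps)
  have cosh_eq: "cosh (\<alpha> * (x m - y n - \<kappa>)) = - \<i> * sinh (\<alpha> * x m - b n + 0)"
    "cosh (\<alpha> * (x m - y n - \<kappa> + r)) = - \<i> * sinh (\<alpha> * x m - b n + \<alpha> * r)" for m n
    unfolding cosh_conv_sinh_shift b_def by (simp_all only: algebra_simps) simp_all
  have xx: "sinh (\<alpha> * (x m - x n + r)) / sinh (\<alpha> * (x m - x n)) = (E * X m - X n / E) / (X m - X n)" for m n
    unfolding x_diff sinh_ratio_exp by (simp add: E_def X_def)
  have yy: "sinh (\<alpha> * (y m - y n - r)) / sinh (\<alpha> * (y m - y n)) = (Y m / E - E * Y n) / (Y m - Y n)" for m n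
    unfolding y_diff sinh_ratio_exp Em Y_def by simp
  have xxyy: "cosh (\<alpha> * (x m - y n - \<kappa>)) / cosh (\<alpha> * (x m - y n - \<kappa> + r)) = (X m - Y n) / (E * X m - Y n / E)" for m n
  proof -
    have "cosh (\<alpha> * (x m - y n - \<kappa>)) / cosh (\<alpha> * (x m - y n - \<kappa> + r))
        = sinh (\<alpha> * x m - b n + 0) / sinh (\<alpha> * x m - b n + \<alpha> * r)"
      unfolding cosh_eq by (rule mult_divide_mult_cancel_left) simp
    thus ?thesis unfolding sinh_ratio_exp by (simp add: E_def X_def Y_def)
  qed
  have ee: "exp (\<alpha> * ((2 * of_nat p + 1 - of_nat l) * r)) = E\<^sup>2 ^ p * E / E ^ l" for p
    unfolding E_def power_mult [symmetric] exp_of_nat_mult [symmetric] exp_add [symmetric] exp_diff [symmetric]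
    by (rule arg_cong[where f = exp]) (simp add: algebra_simps)
  show ?thesis
    unfolding xx yy xxyy ee
  proof (rule source_identity_multiplicative)
    have XX: "X m \<noteq> X n" "E\<^sup>2 * X m \<noteq> X n" if "m \<in> {1..N}" "n \<in> {1..N}" "m \<noteq> n" for m n
      using x[OF that] xr[OF that] unfolding x_diff sinh_diff_plus_eq_0_iff
      by (simp_all add: X_def E_def)
    show "q_generic (E\<^sup>2) {1..N} X"
      unfolding q_generic_def
    proof (intro conjI inj_onI)
      show "m = n" if "m \<in> {1..N}" "n \<in> {1..N}" "X m = X n" for m n
        using XX(1)[OF that(1,2)] that(3) by blast
    qed (use XX(2) E in auto)
    show "inj_on Y {1..N - l}"
    proof (rule inj_onI, rule ccontr)
      fix m n assume *: "m \<in> {1..N - l}" "n \<in> {1..N - l}" "Y m = Y n" "m \<noteq> n"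
      hence "sinh (b m - b n + 0) \<noteq> 0" using y[of m n] unfolding y_diff by blast
      thus False using * unfolding sinh_diff_plus_eq_0_iff by (simp add: Y_def)
    qed
    show "X m \<noteq> Y n" "E\<^sup>2 * X m \<noteq> Y n" if "m \<in> {1..N}" "n \<in> {1..N - l}" for m n
      using xy[OF that] xyr[OF that] unfolding cosh_eq mult_eq_0_iff sinh_diff_plus_eq_0_iff
      by (simp_all add: X_def Y_def E_def)
  qed (use N l in auto)
qed

text \<open>Negating \<rho> reverses the list of arguments of the symmetric function. This makes the
  coefficients the same for both signs \<tau>.\<close>

lemma cf_minus: "cf ap am (- \<rho>) d l j = cf ap am \<rho> d l j"
proof -
  let ?S = "{J. J \<subseteq> {0..<l} \<and> card J = j}" and ?f = "\<lambda>p. l - 1 - p"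
  have inv: "?f (?f p) = p" if "p \<in> {0..<l}" for p using that by auto
  have inj: "inj_on ?f {0..<l}" by (rule inj_on_inverseI[where g = ?f]) (rule inv)
  have img: "?f ` J \<in> ?S" if "J \<in> ?S" for J
    using that card_image[OF inj_on_subset[OF inj, of J]] by auto
  have inv_img: "?f ` ?f ` J = J" if "J \<in> ?S" for J
    using that inv by (force simp: image_image)
  have "(\<Sum>J\<in>?S. \<Prod>r\<in>J. e_d ap am d (of_int (int l - 1 - 2 * int r) * (- \<rho>)))
      = (\<Sum>J\<in>?S. \<Prod>r\<in>J. e_d ap am d (of_int (int l - 1 - 2 * int r) * \<rho>))"
  proof (rule sum.reindex_bij_witness[where i = "image ?f" and j = "image ?f"])
    fix J assume J: "J \<in> ?S"
    have "(\<Prod>r\<in>?f ` J. e_d ap am d (of_int (int l - 1 - 2 * int r) * \<rho>))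
        = (\<Prod>r\<in>J. e_d ap am d (of_int (int l - 1 - 2 * int (?f r)) * \<rho>))"
      using J by (subst prod.reindex[OF inj_on_subset[OF inj]]) auto
    also have "\<dots> = (\<Prod>r\<in>J. e_d ap am d (of_int (int l - 1 - 2 * int r) * (- \<rho>)))"
    proof (rule prod.cong[OF refl])
      fix p assume "p \<in> J"
      hence "p < l" using J by auto
      hence "int (?f p) = int l - 1 - int p" by linarith
      hence "int l - 1 - 2 * int (?f p) = - (int l - 1 - 2 * int p)" by linarith
      thus "e_d ap am d (of_int (int l - 1 - 2 * int (?f p)) * \<rho>) = e_d ap am d (of_int (int l - 1 - 2 * int p) * (- \<rho>))"
        by (simp only: of_int_minus mult_minus_left mult_minus_right)
    qed
    finally show "(\<Prod>r\<in>?f ` J. e_d ap am d (of_int (int l - 1 - 2 * int r) * \<rho>))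
        = (\<Prod>r\<in>J. e_d ap am d (of_int (int l - 1 - 2 * int r) * (- \<rho>)))" .
  qed (use img inv_img in auto)
  thus ?thesis by (simp add: cf_def)
qed

section \<open>The kernel identity\<close>

text \<open>Moving x by t or y by - t changes x - y in the same way, so one family of quotients
  \<open>g\<close> serves here and in \<open>Skernel_shift_right\<close>.\<close>

lemma Skernel_shift_left:
  assumes "I \<subseteq> {1..N}"
    and g: "\<And>m n. m \<in> {1..N} \<Longrightarrow> n \<in> {1..N - l} \<Longrightarrow>
      G (x m - y n + t - \<rho> / 2) / G (x m - y n + t + \<rho> / 2)
        = g m n * (G (x m - y n - \<rho> / 2) / G (x m - y n + \<rho> / 2))"
  shows "Skernel G \<rho> N l (\<lambda>j. if j \<in> I then x j + t else x j) y
    = (\<Prod>m\<in>I. \<Prod>n\<in>{1..N - l}. g m n) * Skernel G \<rho> N l x y"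
proof -
  have "Skernel G \<rho> N l (\<lambda>j. if j \<in> I then x j + t else x j) y
      = (\<Prod>m\<in>{1..N}. (if m \<in> I then \<Prod>n\<in>{1..N - l}. g m n else 1)
          * (\<Prod>n\<in>{1..N - l}. G (x m - y n - \<rho> / 2) / G (x m - y n + \<rho> / 2)))"
    unfolding Skernel_def
  proof (rule prod.cong[OF refl])
    fix m assume m: "m \<in> {1..N}"
    have "x m + t - y n = x m - y n + t" for n by simp
    thus "(\<Prod>n\<in>{1..N - l}. G ((if m \<in> I then x m + t else x m) - y n - \<rho> / 2)
          / G ((if m \<in> I then x m + t else x m) - y n + \<rho> / 2))
      = (if m \<in> I then \<Prod>n\<in>{1..N - l}. g m n else 1)
          * (\<Prod>n\<in>{1..N - l}. G (x m - y n - \<rho> / 2) / G (x m - y n + \<rho> / 2))"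
      using g[OF m] by (cases "m \<in> I") (simp_all only: if_True if_False mult_1_left prod.distrib [symmetric] cong: prod.cong)
  qed
  also have "\<dots> = (\<Prod>m\<in>{1..N}. if m \<in> I then \<Prod>n\<in>{1..N - l}. g m n else 1) * Skernel G \<rho> N l x y"
    by (simp only: prod.distrib Skernel_def)
  also have "(\<Prod>m\<in>{1..N}. if m \<in> I then \<Prod>n\<in>{1..N - l}. g m n else 1) = (\<Prod>m\<in>I. \<Prod>n\<in>{1..N - l}. g m n)"
    using assms(1) by (subst prod.inter_restrict [symmetric]) (auto simp: Int_absorb1)
  finally show ?thesis .
qed

lemma Skernel_shift_right:
  assumes "J \<subseteq> {1..N - l}"
    and g: "\<And>m n. m \<in> {1..N} \<Longrightarrow> n \<in> {1..N - l} \<Longrightarrow>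
      G (x m - y n + t - \<rho> / 2) / G (x m - y n + t + \<rho> / 2)
        = g m n * (G (x m - y n - \<rho> / 2) / G (x m - y n + \<rho> / 2))"
  shows "Skernel G \<rho> N l x (\<lambda>j. if j \<in> J then y j - t else y j)
    = (\<Prod>m\<in>{1..N}. \<Prod>n\<in>J. g m n) * Skernel G \<rho> N l x y"
proof -
  have "Skernel G \<rho> N l x (\<lambda>j. if j \<in> J then y j - t else y j)
      = (\<Prod>m\<in>{1..N}. (\<Prod>n\<in>J. g m n) * (\<Prod>n\<in>{1..N - l}. G (x m - y n - \<rho> / 2) / G (x m - y n + \<rho> / 2)))"
    unfolding Skernel_def
  proof (rule prod.cong[OF refl])
    fix m assume m: "m \<in> {1..N}"
    have "(\<Prod>n\<in>{1..N - l}. G (x m - (if n \<in> J then y n - t else y n) - \<rho> / 2)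
          / G (x m - (if n \<in> J then y n - t else y n) + \<rho> / 2))
       = (\<Prod>n\<in>{1..N - l}. (if n \<in> J then g m n else 1) * (G (x m - y n - \<rho> / 2) / G (x m - y n + \<rho> / 2)))"
    proof (rule prod.cong[OF refl])
      fix n assume n: "n \<in> {1..N - l}"
      have "x m - (y n - t) = x m - y n + t" by simp
      thus "G (x m - (if n \<in> J then y n - t else y n) - \<rho> / 2) / G (x m - (if n \<in> J then y n - t else y n) + \<rho> / 2)
          = (if n \<in> J then g m n else 1) * (G (x m - y n - \<rho> / 2) / G (x m - y n + \<rho> / 2))"
        using g[OF m n] by (cases "n \<in> J") (simp_all only: if_True if_False mult_1_left)
    qed
    also have "\<dots> = (\<Prod>n\<in>{1..N - l}. if n \<in> J then g m n else 1) * (\<Prod>n\<in>{1..N - l}. G (x m - y n - \<rho> / 2) / G (x m - y n + \<rho> / 2))"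
      by (rule prod.distrib)
    also have "(\<Prod>n\<in>{1..N - l}. if n \<in> J then g m n else 1) = (\<Prod>n\<in>J. g m n)"
      using assms(1) by (subst prod.inter_restrict [symmetric]) (auto simp: Int_absorb1)
    finally show "(\<Prod>n\<in>{1..N - l}. G (x m - (if n \<in> J then y n - t else y n) - \<rho> / 2)
          / G (x m - (if n \<in> J then y n - t else y n) + \<rho> / 2)) = (\<Prod>n\<in>J. g m n)
          * (\<Prod>n\<in>{1..N - l}. G (x m - y n - \<rho> / 2) / G (x m - y n + \<rho> / 2))" .
  qed
  also have "\<dots> = (\<Prod>m\<in>{1..N}. \<Prod>n\<in>J. g m n) * Skernel G \<rho> N l x y"
    by (simp only: prod.distrib Skernel_def)
  finally show ?thesis .
qed

section \<open>Genericity and continuity in \<rho>\<close>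

lemma eventually_neq_of_deriv:
  fixes f :: "'a :: real_normed_field \<Rightarrow> 'a"
  assumes "(f has_field_derivative d) (at z)" "d \<noteq> 0"
  shows "eventually (\<lambda>w. f w \<noteq> f z) (at z)"
proof -
  have "((\<lambda>w. (f w - f z) / (w - z)) \<longlongrightarrow> d) (at z)"
    using assms(1) by (simp add: has_field_derivative_iff)
  from tendsto_imp_eventually_ne[OF this assms(2)] show ?thesis
    by eventually_elim auto
qed

text \<open>Zeros of sinh are simple because cosh^2 - sinh^2 = 1, hence isolated.\<close>

lemma eventually_sinh_affine_neq_0:
  fixes a b \<rho> :: complex
  assumes "b \<noteq> 0"
  shows "eventually (\<lambda>r. sinh (a + b * r) \<noteq> 0) (at \<rho>)"
proof (cases "sinh (a + b * \<rho>) = 0")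
  case True
  have "cosh (a + b * \<rho>) \<noteq> 0"
    using hyperbolic_pythagoras[of "a + b * \<rho>"] True by auto
  hence "eventually (\<lambda>r. sinh (a + b * r) \<noteq> sinh (a + b * \<rho>)) (at \<rho>)"
    using assms by (intro eventually_neq_of_deriv[where d = "b * cosh (a + b * \<rho>)"])
      (auto intro!: derivative_eq_intros)
  thus ?thesis using True by simp
next
  case False
  have "((\<lambda>r. sinh (a + b * r)) \<longlongrightarrow> sinh (a + b * \<rho>)) (at \<rho>)"
    by (intro tendsto_intros)
  from tendsto_imp_eventually_ne[OF this False] show ?thesis .
qed

lemma eventually_cosh_affine_neq_0:
  fixes a b \<rho> :: complex
  assumes "b \<noteq> 0"
  shows "eventually (\<lambda>r. cosh (a + b * r) \<noteq> 0) (at \<rho>)"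
  using eventually_sinh_affine_neq_0[OF assms, of "a + \<i> * of_real (pi / 2)" \<rho>]
  by eventually_elim (simp add: cosh_conv_sinh_shift algebra_simps)

lemma eventually_analytic_at: "f analytic_on {z} \<Longrightarrow> eventually (\<lambda>w. f analytic_on {w}) (nhds z)"
  unfolding analytic_at eventually_nhds by blast

lemma tendsto_Skernel:
  assumes "\<And>m n. m \<in> {1..N} \<Longrightarrow> n \<in> {1..N - l} \<Longrightarrow> G analytic_on {x m - y n - \<rho> / 2}
     \<and> G analytic_on {x m - y n + \<rho> / 2} \<and> G (x m - y n + \<rho> / 2) \<noteq> 0"
  shows "((\<lambda>r. Skernel G r N l x y) \<longlongrightarrow> Skernel G \<rho> N l x y) (at \<rho>)"
  unfolding Skernel_def
proof (intro tendsto_prod tendsto_divide)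
  fix m n assume mn: "m \<in> {1..N}" "n \<in> {1..N - l}"
  show "((\<lambda>r. G (x m - y n - r / 2)) \<longlongrightarrow> G (x m - y n - \<rho> / 2)) (at \<rho>)"
    using assms[OF mn] by (intro isCont_tendsto_compose[of _ G] analytic_at_imp_isCont tendsto_intros) auto
  show "((\<lambda>r. G (x m - y n + r / 2)) \<longlongrightarrow> G (x m - y n + \<rho> / 2)) (at \<rho>)"
    using assms[OF mn] by (intro isCont_tendsto_compose[of _ G] analytic_at_imp_isCont tendsto_intros) auto
qed (use assms in auto)

lemma tendsto_Aop:
  assumes x: "\<And>m n. m \<in> {1..n0} \<Longrightarrow> n \<in> {1..n0} \<Longrightarrow> m \<noteq> n \<Longrightarrow> s_d ap am d (x m - x n) \<noteq> 0"
    and f: "\<And>I. I \<subseteq> {1..n0} \<Longrightarrow>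
      ((\<lambda>r. f r (\<lambda>j. if j \<in> I then x j - pmsign s * \<i> * of_real (adelta ap am (pmneg d)) else x j))
        \<longlongrightarrow> f \<rho> (\<lambda>j. if j \<in> I then x j - pmsign s * \<i> * of_real (adelta ap am (pmneg d)) else x j)) (at \<rho>)"
    and pos: "ap > 0" "am > 0"
  shows "((\<lambda>r. Aop ap am r s d n0 k (f r) x) \<longlongrightarrow> Aop ap am \<rho> s d n0 k (f \<rho>) x) (at \<rho>)"
proof -
  have "adelta ap am d \<noteq> 0" using pos by (cases d) auto
  hence sd: "((\<lambda>r. s_d ap am d (c - pmsign s * r)) \<longlongrightarrow> s_d ap am d (c - pmsign s * \<rho>)) (at \<rho>)" for c
    unfolding s_d_def by (intro tendsto_intros) auto
  have nz: "s_d ap am d (x m - x n) \<noteq> 0"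
    if "I \<in> {I. I \<subseteq> {1..n0} \<and> card I = k}" "m \<in> I" "n \<in> {1..n0} - I" for I m n
    using that by (intro x) auto
  show ?thesis
    unfolding Aop_def
    by (intro tendsto_sum tendsto_mult tendsto_prod tendsto_divide tendsto_const sd f) (use nz in auto)
qed

lemma tendsto_cf:
  assumes "ap > 0" "am > 0"
  shows "((\<lambda>r. cf ap am r d l j) \<longlongrightarrow> cf ap am \<rho> d l j) (at \<rho>)"
proof -
  have "adelta ap am d \<noteq> 0" using assms by (cases d) auto
  thus ?thesis unfolding cf_def e_d_def by (auto intro!: tendsto_intros)
qed

section \<open>The kernel identity, first for generic \<rho>\<close>

text \<open>By the shift equation both sides are \<open>Skernel G \<rho> N l x y\<close> times a sum
  over subsets, and these sums are compared by \<open>source_identity_hyperbolic\<close>. The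
  conditions \<open>genx\<close> and \<open>genxy\<close> supply the nonvanishing that it demands of
  shifted arguments.\<close>

lemma kernel_identity_generic:
  fixes ap am :: real and \<rho> :: complex and G :: "complex \<Rightarrow> complex"
    and N l k :: nat and \<tau> \<delta> :: pm and x y :: "nat \<Rightarrow> complex"
  defines "\<alpha> \<equiv> of_real pi / of_real (adelta ap am \<delta>)" and "p \<equiv> adelta ap am (pmneg \<delta>)"
  assumes N: "N \<ge> 1" and l: "l \<le> N"
    and shift: "\<And>z. G analytic_on {z + \<i> * of_real p / 2} \<Longrightarrow> G analytic_on {z - \<i> * of_real p / 2} \<Longrightarrow>
        G (z + \<i> * of_real p / 2) = 2 * cosh (\<alpha> * z) * G (z - \<i> * of_real p / 2)"
    and regG: "\<And>m n t. m \<in> {1..N} \<Longrightarrow> n \<in> {1..N - l} \<Longrightarrow> t \<in> {0, \<i> * of_real p, - \<i> * of_real p}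
        \<Longrightarrow> G analytic_on {x m - y n + t - \<rho> / 2} \<and> G analytic_on {x m - y n + t + \<rho> / 2}
            \<and> G (x m - y n + t + \<rho> / 2) \<noteq> 0"
    and regx: "\<And>m n. m \<in> {1..N} \<Longrightarrow> n \<in> {1..N} \<Longrightarrow> m \<noteq> n \<Longrightarrow> s_d ap am \<delta> (x m - x n) \<noteq> 0"
    and regy: "\<And>m n. m \<in> {1..N - l} \<Longrightarrow> n \<in> {1..N - l} \<Longrightarrow> m \<noteq> n \<Longrightarrow> s_d ap am \<delta> (y m - y n) \<noteq> 0"
    and genx: "\<And>m n. m \<in> {1..N} \<Longrightarrow> n \<in> {1..N} \<Longrightarrow> m \<noteq> n \<Longrightarrow>
        sinh (\<alpha> * (x m - x n - pmsign \<tau> * \<rho>)) \<noteq> 0"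
    and genxy: "\<And>m n c. m \<in> {1..N} \<Longrightarrow> n \<in> {1..N - l} \<Longrightarrow> c \<in> {1 / 2, - 1 / 2} \<Longrightarrow>
        cosh (\<alpha> * (x m - y n - pmsign \<tau> * (\<i> * of_real p / 2) + c * \<rho>)) \<noteq> 0"
  shows "Aop ap am \<rho> \<tau> \<delta> N k (\<lambda>x'. Skernel G \<rho> N l x' y) x
       = (\<Sum>j = 0..min k l. cf ap am \<rho> \<delta> l j
            * Aop ap am \<rho> (pmneg \<tau>) \<delta> (N - l) (k - j) (\<lambda>y'. Skernel G \<rho> N l x y') y)"
proof -
  define \<sigma> where "\<sigma> = pmsign \<tau>"
  have neg: "pmsign (pmneg \<tau>) = - \<sigma>" by (cases \<tau>) (auto simp: \<sigma>_def)
  define r where "r = - (\<sigma> * \<rho>)"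
  \<comment> \<open>Chosen so that x - y - \<kappa> and x - y - \<kappa> + r are the midpoints of
    the two steps that the shift equation makes in the numerator and denominator of a kernel
    factor.\<close>
  define \<kappa> where "\<kappa> = \<sigma> * (\<i> * of_real p / 2 - \<rho> / 2)"
  define t where "t = - (\<sigma> * \<i> * of_real p)"
  define g where "g = (\<lambda>m n. cosh (\<alpha> * (x m - y n - \<kappa>)) / cosh (\<alpha> * (x m - y n - \<kappa> + r)))"
  have s_d: "s_d ap am \<delta> z = sinh (\<alpha> * z)" for z by (simp add: s_d_def \<alpha>_def)
  have e_d: "e_d ap am \<delta> z = exp (\<alpha> * z)" for z by (simp add: e_d_def \<alpha>_def)
  have half: "\<sigma> / 2 \<in> {1 / 2, - 1 / 2}" "- \<sigma> / 2 \<in> {1 / 2, - 1 / 2}"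
    by (cases \<tau>; simp add: \<sigma>_def)+
  have c1: "cosh (\<alpha> * (x m - y n - \<kappa>)) \<noteq> 0"
    and c2: "cosh (\<alpha> * (x m - y n - \<kappa> + r)) \<noteq> 0" if "m \<in> {1..N}" "n \<in> {1..N - l}" for m n
  proof -
    have "x m - y n - \<kappa> = x m - y n - pmsign \<tau> * (\<i> * of_real p / 2) + \<sigma> / 2 * \<rho>"
      "x m - y n - \<kappa> + r = x m - y n - pmsign \<tau> * (\<i> * of_real p / 2) + - \<sigma> / 2 * \<rho>"
      by (simp_all add: \<kappa>_def r_def \<sigma>_def algebra_simps)
    thus "cosh (\<alpha> * (x m - y n - \<kappa>)) \<noteq> 0" "cosh (\<alpha> * (x m - y n - \<kappa> + r)) \<noteq> 0"
      using genxy[OF that half(1)] genxy[OF that half(2)] by metis+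
  qed
  \<comment> \<open>The shift equation recentred at its upper point. For \<open>Pl\<close> the
    translated argument lies below the original one, for \<open>Mi\<close> above it.\<close>
  have shift': "G (w + u) = 2 * cosh (\<alpha> * (w + u - \<i> * of_real p / 2)) * G (w + u - \<i> * of_real p)"
    if "G analytic_on {w + u}" "G analytic_on {w + u - \<i> * of_real p}" for w u
    using shift[of "w + u - \<i> * of_real p / 2"] that by simp
  have step: "G (x m - y n + t - \<rho> / 2) / G (x m - y n + t + \<rho> / 2)
        = g m n * (G (x m - y n - \<rho> / 2) / G (x m - y n + \<rho> / 2))"
    if mn: "m \<in> {1..N}" "n \<in> {1..N - l}" for m n
  proof (cases \<tau>)
    case Pl
    define w where "w = x m - y n"
    have vals: "t = - \<i> * of_real p" "w - \<kappa> = w + \<rho> / 2 - \<i> * of_real p / 2"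
      "w - \<kappa> + r = w + - \<rho> / 2 - \<i> * of_real p / 2"
      using Pl by (simp_all add: t_def \<kappa>_def r_def \<sigma>_def field_simps)
    have an: "G analytic_on {w - \<rho> / 2}" "G analytic_on {w + \<rho> / 2}" "G (w + \<rho> / 2) \<noteq> 0"
      "G analytic_on {w + t - \<rho> / 2}" "G analytic_on {w + t + \<rho> / 2}" "G (w + t + \<rho> / 2) \<noteq> 0"
      using regG[OF mn, of 0] regG[OF mn, of t] vals(1) by (simp_all add: w_def)
    have eq: "w + \<rho> / 2 - \<i> * of_real p = w + t + \<rho> / 2" "w + - \<rho> / 2 - \<i> * of_real p = w + t - \<rho> / 2"
      using vals(1) by simp_all
    have 1: "G (w + \<rho> / 2) = 2 * cosh (\<alpha> * (w - \<kappa>)) * G (w + t + \<rho> / 2)"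
      using shift'[of w "\<rho> / 2"] an unfolding vals(2) eq by simp
    have 2: "G (w - \<rho> / 2) = 2 * cosh (\<alpha> * (w - \<kappa> + r)) * G (w + t - \<rho> / 2)"
      using shift'[of w "- \<rho> / 2"] an unfolding vals(3) eq by simp
    have "A / B = C / D * ((2 * D * A) / (2 * C * B))" if "C \<noteq> 0" "D \<noteq> 0" for A B C D :: complex
      using that by (simp add: field_simps)
    thus ?thesis
      using c1[OF mn] c2[OF mn] unfolding g_def w_def [symmetric] 1 2 by blast
  next
    case Mi
    define w where "w = x m - y n"
    have vals: "t = \<i> * of_real p" "w - \<kappa> = w + t + - \<rho> / 2 - \<i> * of_real p / 2"
      "w - \<kappa> + r = w + t + \<rho> / 2 - \<i> * of_real p / 2"
      using Mi by (simp_all add: t_def \<kappa>_def r_def \<sigma>_def field_simps)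
    have an: "G analytic_on {w - \<rho> / 2}" "G analytic_on {w + \<rho> / 2}" "G (w + \<rho> / 2) \<noteq> 0"
      "G analytic_on {w + t - \<rho> / 2}" "G analytic_on {w + t + \<rho> / 2}" "G (w + t + \<rho> / 2) \<noteq> 0"
      using regG[OF mn, of 0] regG[OF mn, of t] vals(1) by (simp_all add: w_def)
    have eq: "w + t + \<rho> / 2 - \<i> * of_real p = w + \<rho> / 2" "w + t + - \<rho> / 2 - \<i> * of_real p = w - \<rho> / 2"
      using vals(1) by simp_all
    have 1: "G (w + t + \<rho> / 2) = 2 * cosh (\<alpha> * (w - \<kappa> + r)) * G (w + \<rho> / 2)"
      using shift'[of "w + t" "\<rho> / 2"] an unfolding vals(3) eq by simp
    have 2: "G (w + t - \<rho> / 2) = 2 * cosh (\<alpha> * (w - \<kappa>)) * G (w - \<rho> / 2)"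
      using shift'[of "w + t" "- \<rho> / 2"] an unfolding vals(2) eq by simp
    show ?thesis
      unfolding g_def w_def [symmetric] 1 2 by simp
  qed
  have A_x: "Aop ap am \<rho> \<tau> \<delta> N k (\<lambda>x'. Skernel G \<rho> N l x' y) x
      = (\<Sum>I | I \<subseteq> {1..N} \<and> card I = k.
          (\<Prod>m\<in>I. \<Prod>n\<in>{1..N} - I. sinh (\<alpha> * (x m - x n + r)) / sinh (\<alpha> * (x m - x n)))
          * (\<Prod>m\<in>I. \<Prod>n\<in>{1..N - l}. g m n)) * Skernel G \<rho> N l x y"
    unfolding Aop_def sum_distrib_right
  proof (rule sum.cong[OF refl])
    fix I assume "I \<in> {I. I \<subseteq> {1..N} \<and> card I = k}"
    hence "Skernel G \<rho> N l (\<lambda>j. if j \<in> I then x j + t else x j) y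
        = (\<Prod>m\<in>I. \<Prod>n\<in>{1..N - l}. g m n) * Skernel G \<rho> N l x y"
      using step by (intro Skernel_shift_left) auto
    moreover have "x j + t = x j - pmsign \<tau> * \<i> * of_real (adelta ap am (pmneg \<delta>))" for j
      by (simp add: t_def \<sigma>_def p_def)
    moreover have "x m - x n - pmsign \<tau> * \<rho> = x m - x n + r" for m n
      by (simp add: r_def \<sigma>_def)
    ultimately show "(\<Prod>m\<in>I. \<Prod>n'\<in>{1..N} - I. s_d ap am \<delta> (x m - x n' - pmsign \<tau> * \<rho>) / s_d ap am \<delta> (x m - x n'))
         * Skernel G \<rho> N l (\<lambda>j. if j \<in> I then x j - pmsign \<tau> * \<i> * of_real (adelta ap am (pmneg \<delta>)) else x j) y
       = (\<Prod>m\<in>I. \<Prod>n\<in>{1..N} - I. sinh (\<alpha> * (x m - x n + r)) / sinh (\<alpha> * (x m - x n)))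
          * (\<Prod>m\<in>I. \<Prod>n\<in>{1..N - l}. g m n) * Skernel G \<rho> N l x y"
      by (simp only: s_d mult.assoc)
  qed
  have A_y: "Aop ap am \<rho> (pmneg \<tau>) \<delta> (N - l) i (\<lambda>y'. Skernel G \<rho> N l x y') y
      = (\<Sum>J | J \<subseteq> {1..N - l} \<and> card J = i.
          (\<Prod>m\<in>J. \<Prod>n\<in>{1..N - l} - J. sinh (\<alpha> * (y m - y n - r)) / sinh (\<alpha> * (y m - y n)))
          * (\<Prod>m\<in>{1..N}. \<Prod>n\<in>J. g m n)) * Skernel G \<rho> N l x y" for i
    unfolding Aop_def sum_distrib_right
  proof (rule sum.cong[OF refl])
    fix J assume "J \<in> {J. J \<subseteq> {1..N - l} \<and> card J = i}"
    hence "Skernel G \<rho> N l x (\<lambda>j. if j \<in> J then y j - t else y j)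
        = (\<Prod>m\<in>{1..N}. \<Prod>n\<in>J. g m n) * Skernel G \<rho> N l x y"
      using step by (intro Skernel_shift_right) auto
    moreover have "y j - t = y j - pmsign (pmneg \<tau>) * \<i> * of_real (adelta ap am (pmneg \<delta>))" for j
      by (simp add: t_def neg p_def)
    moreover have "y m - y n - pmsign (pmneg \<tau>) * \<rho> = y m - y n - r" for m n
      by (simp add: r_def neg)
    ultimately show "(\<Prod>m\<in>J. \<Prod>n'\<in>{1..N - l} - J. s_d ap am \<delta> (y m - y n' - pmsign (pmneg \<tau>) * \<rho>) / s_d ap am \<delta> (y m - y n'))
         * Skernel G \<rho> N l x (\<lambda>j. if j \<in> J then y j - pmsign (pmneg \<tau>) * \<i> * of_real (adelta ap am (pmneg \<delta>)) else y j)
       = (\<Prod>m\<in>J. \<Prod>n\<in>{1..N - l} - J. sinh (\<alpha> * (y m - y n - r)) / sinh (\<alpha> * (y m - y n)))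
          * (\<Prod>m\<in>{1..N}. \<Prod>n\<in>J. g m n) * Skernel G \<rho> N l x y"
      by (simp only: s_d mult.assoc)
  qed
  \<comment> \<open>Since (2 p + 1 - l) r = (l - 1 - 2 p) (- r) and - r is \<rho> or - \<rho>, these
    are the coefficients up to the sign removed by \<open>cf_minus\<close>.\<close>
  have cf: "(\<Sum>K | K \<subseteq> {..<l} \<and> card K = j. \<Prod>p\<in>K. exp (\<alpha> * ((2 * of_nat p + 1 - of_nat l) * r))) = cf ap am \<rho> \<delta> l j" for j
  proof -
    have "cf ap am (- r) \<delta> l j = cf ap am \<rho> \<delta> l j"
      by (cases \<tau>) (simp_all add: r_def \<sigma>_def cf_minus)
    moreover have "cf ap am (- r) \<delta> l j
        = (\<Sum>K | K \<subseteq> {..<l} \<and> card K = j. \<Prod>p\<in>K. exp (\<alpha> * ((2 * of_nat p + 1 - of_nat l) * r)))"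
    proof (cases "j \<le> l")
      case True
      have "of_int (int l - 1 - 2 * int p) * (- r) = (2 * of_nat p + 1 - of_nat l) * r" for p
        by (simp add: algebra_simps)
      thus ?thesis using True unfolding cf_def e_d by (simp only: if_True atLeast0LessThan)
    next
      case False
      have "{K. K \<subseteq> {..<l} \<and> card K = j} = {}"
        using False card_mono[of "{..<l}"] by auto
      thus ?thesis using False by (simp only: cf_def if_False sum.empty)
    qed
    ultimately show ?thesis by simp
  qed
  have "(\<Sum>I | I \<subseteq> {1..N} \<and> card I = k.
          (\<Prod>m\<in>I. \<Prod>n\<in>{1..N} - I. sinh (\<alpha> * (x m - x n + r)) / sinh (\<alpha> * (x m - x n)))
          * (\<Prod>m\<in>I. \<Prod>n\<in>{1..N - l}. g m n))
      = (\<Sum>j\<le>k. cf ap am \<rho> \<delta> l j * (\<Sum>J | J \<subseteq> {1..N - l} \<and> card J = k - j.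
          (\<Prod>m\<in>J. \<Prod>n\<in>{1..N - l} - J. sinh (\<alpha> * (y m - y n - r)) / sinh (\<alpha> * (y m - y n)))
          * (\<Prod>m\<in>{1..N}. \<Prod>n\<in>J. g m n)))"
    unfolding g_def cf [symmetric]
  proof (rule source_identity_hyperbolic[OF N l])
    show "sinh (\<alpha> * (x m - x n + r)) \<noteq> 0" if "m \<in> {1..N}" "n \<in> {1..N}" "m \<noteq> n" for m n
      using genx[OF that] by (simp add: r_def \<sigma>_def)
  qed (use regx regy c1 c2 s_d in auto)
  hence "Aop ap am \<rho> \<tau> \<delta> N k (\<lambda>x'. Skernel G \<rho> N l x' y) x
      = (\<Sum>j\<le>k. cf ap am \<rho> \<delta> l j * Aop ap am \<rho> (pmneg \<tau>) \<delta> (N - l) (k - j) (\<lambda>y'. Skernel G \<rho> N l x y') y)"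
    unfolding A_x A_y by (simp only: sum_distrib_right mult.assoc)
  \<comment> \<open>The terms with j > l vanish by the default value of \<open>cf\<close>. For k - j
    > N - l, \<open>Aop\<close> is a sum over no subsets, in agreement with the convention that the
    operator is 0.\<close>
  also have "\<dots> = (\<Sum>j = 0..min k l. cf ap am \<rho> \<delta> l j
      * Aop ap am \<rho> (pmneg \<tau>) \<delta> (N - l) (k - j) (\<lambda>y'. Skernel G \<rho> N l x y') y)"
    by (rule sum.mono_neutral_right) (auto simp: cf_def)
  finally show ?thesis .
qed

text \<open>The meromorphic identity is stated pointwise. \<open>regG\<close> asks for regularity of
  G at x - y - \<rho> / 2 and x - y + \<rho> / 2, unshifted or moved one step either way, and for
  nonzero denominators of the kernel; \<open>regx\<close> and \<open>regy\<close> do the same for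
  the coefficients of the operators.\<close>

theorem theorem2p1:
  fixes ap am :: real and \<rho> :: complex and G :: "complex \<Rightarrow> complex"
    and N l k :: nat and \<tau> \<delta> :: pm and x y :: "nat \<Rightarrow> complex"
  assumes ap: "ap > 0" and am: "am > 0"
    and G_mero: "G meromorphic_on UNIV"
    and G_strip: "\<And>z. \<bar>Im z\<bar> < (ap + am) / 2 \<Longrightarrow> G z = hyp_gamma_integral ap am z"
    and N: "N \<ge> 1" and l: "l \<le> N" and k: "1 \<le> k" "k \<le> N"
    and regG: "\<And>m n t. m \<in> {1..N} \<Longrightarrow> n \<in> {1..N - l}
        \<Longrightarrow> t \<in> {0, \<i> * of_real (adelta ap am (pmneg \<delta>)), - \<i> * of_real (adelta ap am (pmneg \<delta>))}
        \<Longrightarrow> G analytic_on {x m - y n + t - \<rho> / 2} \<and> G analytic_on {x m - y n + t + \<rho> / 2}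
            \<and> G (x m - y n + t + \<rho> / 2) \<noteq> 0"
    and regx: "\<And>m n. m \<in> {1..N} \<Longrightarrow> n \<in> {1..N} \<Longrightarrow> m \<noteq> n \<Longrightarrow> s_d ap am \<delta> (x m - x n) \<noteq> 0"
    and regy: "\<And>m n. m \<in> {1..N - l} \<Longrightarrow> n \<in> {1..N - l} \<Longrightarrow> m \<noteq> n \<Longrightarrow> s_d ap am \<delta> (y m - y n) \<noteq> 0"
  shows "Aop ap am \<rho> \<tau> \<delta> N k (\<lambda>x'. Skernel G \<rho> N l x' y) x
       = (\<Sum>j = 0..min k l. cf ap am \<rho> \<delta> l j
            * Aop ap am \<rho> (pmneg \<tau>) \<delta> (N - l) (k - j) (\<lambda>y'. Skernel G \<rho> N l x y') y)"
proof -
  define \<alpha> :: complex where "\<alpha> = of_real pi / of_real (adelta ap am \<delta>)"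
  define p where "p = adelta ap am (pmneg \<delta>)"
  define T where "T = {0, \<i> * of_real p, - \<i> * complex_of_real p}"
  have \<alpha>: "\<alpha> \<noteq> 0" using ap am by (cases \<delta>) (auto simp: \<alpha>_def)
  have \<sigma>: "pmsign \<tau> \<noteq> 0" by (cases \<tau>) auto
  \<comment> \<open>The step p belongs to the sign opposite to \<delta>. For \<open>Pl\<close> the
    two periods are therefore exchanged, which the symmetry of the integral permits.\<close>
  have shift: "G (z + \<i> * of_real p / 2) = 2 * cosh (\<alpha> * z) * G (z - \<i> * of_real p / 2)"
    if "G analytic_on {z + \<i> * of_real p / 2}" "G analytic_on {z - \<i> * of_real p / 2}" for z
  proof (cases \<delta>)
    case Pl
    from that hyp_gamma_shift[OF am ap G_mero, of z] G_strip hyp_gamma_integral_commute[of am ap]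
    show ?thesis by (simp add: Pl p_def \<alpha>_def add.commute)
  next
    case Mi
    from that hyp_gamma_shift[OF ap am G_mero, of z] G_strip
    show ?thesis by (simp add: Mi p_def \<alpha>_def)
  qed
  have regG': "G analytic_on {x m - y n + t - \<rho> / 2} \<and> G analytic_on {x m - y n + t + \<rho> / 2}
            \<and> G (x m - y n + t + \<rho> / 2) \<noteq> 0" if "m \<in> {1..N}" "n \<in> {1..N - l}" "t \<in> T" for m n t
    using regG[OF that(1,2), of t] that(3) by (simp add: T_def p_def)
  \<comment> \<open>Both sides are continuous in \<open>\<rho>\<close> and \<open>regG\<close> is an open condition, whereas the additional
      genericity needed for the determinant argument fails only at isolated values of \<open>\<rho>\<close>.\<close>
  define L where "L = (\<lambda>r. Aop ap am r \<tau> \<delta> N k (\<lambda>x'. Skernel G r N l x' y) x)"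
  define R where "R = (\<lambda>r. \<Sum>j = 0..min k l. cf ap am r \<delta> l j
            * Aop ap am r (pmneg \<tau>) \<delta> (N - l) (k - j) (\<lambda>y'. Skernel G r N l x y') y)"
  have pm_T: "- (pmsign s * \<i> * of_real p) \<in> T" "pmsign s * \<i> * of_real p \<in> T" for s
    by (cases s; simp add: T_def)+
  have L: "(L \<longlongrightarrow> L \<rho>) (at \<rho>)"
    unfolding L_def
  proof (rule tendsto_Aop[OF regx _ ap am])
    fix I
    show "((\<lambda>r. Skernel G r N l (\<lambda>j. if j \<in> I then x j - pmsign \<tau> * \<i> * of_real (adelta ap am (pmneg \<delta>)) else x j) y)
       \<longlongrightarrow> Skernel G \<rho> N l (\<lambda>j. if j \<in> I then x j - pmsign \<tau> * \<i> * of_real (adelta ap am (pmneg \<delta>)) else x j) y) (at \<rho>)"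
    proof (rule tendsto_Skernel)
      fix m n assume mn: "m \<in> {1..N}" "n \<in> {1..N - l}"
      have eq: "x m - pmsign \<tau> * \<i> * of_real (adelta ap am (pmneg \<delta>)) - y n = x m - y n + - (pmsign \<tau> * \<i> * of_real p)"
        by (simp add: p_def)
      show "G analytic_on {(if m \<in> I then x m - pmsign \<tau> * \<i> * of_real (adelta ap am (pmneg \<delta>)) else x m) - y n - \<rho> / 2}
         \<and> G analytic_on {(if m \<in> I then x m - pmsign \<tau> * \<i> * of_real (adelta ap am (pmneg \<delta>)) else x m) - y n + \<rho> / 2}
         \<and> G ((if m \<in> I then x m - pmsign \<tau> * \<i> * of_real (adelta ap am (pmneg \<delta>)) else x m) - y n + \<rho> / 2) \<noteq> 0"
      proof (cases "m \<in> I")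
        case True
        show ?thesis unfolding if_P[OF True] eq by (rule regG'[OF mn pm_T(1)])
      qed (use regG'[OF mn, of 0] in \<open>simp add: T_def\<close>)
    qed
  qed
  have R: "(R \<longlongrightarrow> R \<rho>) (at \<rho>)"
    unfolding R_def
  proof (intro tendsto_sum tendsto_mult tendsto_cf[OF ap am] tendsto_Aop[OF regy _ ap am])
    fix I
    show "((\<lambda>r. Skernel G r N l x (\<lambda>j. if j \<in> I then y j - pmsign (pmneg \<tau>) * \<i> * of_real (adelta ap am (pmneg \<delta>)) else y j))
       \<longlongrightarrow> Skernel G \<rho> N l x (\<lambda>j. if j \<in> I then y j - pmsign (pmneg \<tau>) * \<i> * of_real (adelta ap am (pmneg \<delta>)) else y j)) (at \<rho>)"
    proof (rule tendsto_Skernel)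
      fix m n assume mn: "m \<in> {1..N}" "n \<in> {1..N - l}"
      have eq: "x m - (y n - pmsign (pmneg \<tau>) * \<i> * of_real (adelta ap am (pmneg \<delta>))) = x m - y n + pmsign (pmneg \<tau>) * \<i> * of_real p"
        by (simp add: p_def)
      show "G analytic_on {x m - (if n \<in> I then y n - pmsign (pmneg \<tau>) * \<i> * of_real (adelta ap am (pmneg \<delta>)) else y n) - \<rho> / 2}
         \<and> G analytic_on {x m - (if n \<in> I then y n - pmsign (pmneg \<tau>) * \<i> * of_real (adelta ap am (pmneg \<delta>)) else y n) + \<rho> / 2}
         \<and> G (x m - (if n \<in> I then y n - pmsign (pmneg \<tau>) * \<i> * of_real (adelta ap am (pmneg \<delta>)) else y n) + \<rho> / 2) \<noteq> 0"
      proof (cases "n \<in> I")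
        case True
        show ?thesis unfolding if_P[OF True] eq by (rule regG'[OF mn pm_T(2)])
      qed (use regG'[OF mn, of 0] in \<open>simp add: T_def\<close>)
    qed
  qed
  have "eventually (\<lambda>r. L r = R r) (at \<rho>)"
  proof -
    have evG: "eventually (\<lambda>r. \<forall>m\<in>{1..N}. \<forall>n\<in>{1..N - l}. \<forall>t\<in>T. G analytic_on {x m - y n + t - r / 2}
        \<and> G analytic_on {x m - y n + t + r / 2} \<and> G (x m - y n + t + r / 2) \<noteq> 0) (at \<rho>)"
    proof (intro eventually_ball_finite ballI eventually_conj)
      fix m n t assume *: "m \<in> {1..N}" "n \<in> {1..N - l}" "t \<in> T"
      have lim: "((\<lambda>r. x m - y n + t - r / 2) \<longlongrightarrow> x m - y n + t - \<rho> / 2) (at \<rho>)"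
        "((\<lambda>r. x m - y n + t + r / 2) \<longlongrightarrow> x m - y n + t + \<rho> / 2) (at \<rho>)"
        by (intro tendsto_intros; simp)+
      note reg = regG'[OF *]
      show "eventually (\<lambda>r. G analytic_on {x m - y n + t - r / 2}) (at \<rho>)"
        using reg by (intro eventually_compose_filterlim[OF eventually_analytic_at lim(1)]) auto
      show "eventually (\<lambda>r. G analytic_on {x m - y n + t + r / 2}) (at \<rho>)"
        using reg by (intro eventually_compose_filterlim[OF eventually_analytic_at lim(2)]) auto
      have "((\<lambda>r. G (x m - y n + t + r / 2)) \<longlongrightarrow> G (x m - y n + t + \<rho> / 2)) (at \<rho>)"
        using reg by (intro isCont_tendsto_compose[OF _ lim(2)] analytic_at_imp_isCont) auto
      thus "eventually (\<lambda>r. G (x m - y n + t + r / 2) \<noteq> 0) (at \<rho>)"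
        by (rule tendsto_imp_eventually_ne) (use reg in auto)
    qed (auto simp: T_def)
    \<comment> \<open>Pairs with m = n may be included: even then the argument is a nonconstant
      affine function of r, and the neighbourhood is punctured.\<close>
    have evx: "eventually (\<lambda>r. \<forall>m\<in>{1..N}. \<forall>n\<in>{1..N}. sinh (\<alpha> * (x m - x n - pmsign \<tau> * r)) \<noteq> 0) (at \<rho>)"
    proof (intro eventually_ball_finite ballI finite_atLeastAtMost)
      fix m n
      have "\<alpha> * (x m - x n - pmsign \<tau> * r) = \<alpha> * (x m - x n) + (- \<alpha> * pmsign \<tau>) * r" for r
        by (simp add: algebra_simps)
      thus "eventually (\<lambda>r. sinh (\<alpha> * (x m - x n - pmsign \<tau> * r)) \<noteq> 0) (at \<rho>)"
        using \<alpha> \<sigma> by (simp only:) (rule eventually_sinh_affine_neq_0, simp)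
    qed
    have evxy: "eventually (\<lambda>r. \<forall>m\<in>{1..N}. \<forall>n\<in>{1..N - l}. \<forall>c\<in>{1 / 2, - 1 / 2}.
        cosh (\<alpha> * (x m - y n - pmsign \<tau> * (\<i> * of_real p / 2) + c * r)) \<noteq> 0) (at \<rho>)"
    proof (intro eventually_ball_finite ballI finite_atLeastAtMost)
      fix m n and c :: complex assume c: "c \<in> {1 / 2, - 1 / 2}"
      have "\<alpha> * (x m - y n - pmsign \<tau> * (\<i> * of_real p / 2) + c * r)
          = \<alpha> * (x m - y n - pmsign \<tau> * (\<i> * of_real p / 2)) + (\<alpha> * c) * r" for r
        by (simp add: algebra_simps)
      thus "eventually (\<lambda>r. cosh (\<alpha> * (x m - y n - pmsign \<tau> * (\<i> * of_real p / 2) + c * r)) \<noteq> 0) (at \<rho>)"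
        using \<alpha> c by (simp only:) (rule eventually_cosh_affine_neq_0, auto)
    qed simp
    from evG evx evxy show ?thesis
    proof eventually_elim
      case (elim r)
      show ?case unfolding L_def R_def
      proof (rule kernel_identity_generic[OF N l])
        show "G (z + \<i> * of_real (adelta ap am (pmneg \<delta>)) / 2)
            = 2 * cosh (of_real pi / of_real (adelta ap am \<delta>) * z) * G (z - \<i> * of_real (adelta ap am (pmneg \<delta>)) / 2)"
          if "G analytic_on {z + \<i> * of_real (adelta ap am (pmneg \<delta>)) / 2}"
            "G analytic_on {z - \<i> * of_real (adelta ap am (pmneg \<delta>)) / 2}" for z
          using shift[of z] that by (simp only: p_def \<alpha>_def)
        fix m n
        show "G analytic_on {x m - y n + t - r / 2} \<and> G analytic_on {x m - y n + t + r / 2}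
            \<and> G (x m - y n + t + r / 2) \<noteq> 0"
          if "m \<in> {1..N}" "n \<in> {1..N - l}"
            "t \<in> {0, \<i> * of_real (adelta ap am (pmneg \<delta>)), - \<i> * of_real (adelta ap am (pmneg \<delta>))}" for t
          using elim(1) that unfolding T_def p_def by blast
        show "sinh (of_real pi / of_real (adelta ap am \<delta>) * (x m - x n - pmsign \<tau> * r)) \<noteq> 0"
          if "m \<in> {1..N}" "n \<in> {1..N}" "m \<noteq> n"
          using elim(2) that unfolding \<alpha>_def by blast
        show "cosh (of_real pi / of_real (adelta ap am \<delta>)
            * (x m - y n - pmsign \<tau> * (\<i> * of_real (adelta ap am (pmneg \<delta>)) / 2) + c * r)) \<noteq> 0"
          if "m \<in> {1..N}" "n \<in> {1..N - l}" "c \<in> {1 / 2, - 1 / 2}" for c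
          using elim(3) that unfolding \<alpha>_def p_def by blast
      qed (use regx regy in auto)
    qed
  qed
  hence "(L \<longlongrightarrow> R \<rho>) (at \<rho>)" using R by (simp add: tendsto_cong)
  with L have "L \<rho> = R \<rho>" by (intro tendsto_unique[of "at \<rho>" L]) auto
  thus ?thesis by (simp only: L_def R_def)
qed

end
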